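(* (1) Let $\mathcal P$ be a chiral or directly regular polytope. Then $\mathcal P \diamond \mathcal P^{\delta}$ is properly self-dual. (2) Let $\mathcal P$ be a chiral polytope and let $\mathcal Q = \mathcal P \diamond \overline{\mathcal P^{\delta}}$. Then $\mathcal Q = \overline{\mathcal Q^{\delta}}$; if $\mathcal Q$ is directly regular then it is (properly) self-dual, and if $\mathcal Q$ is chiral then it is improperly self-dual.
   Context: An abstract polytope of rank $n$ (an $n$-polytope) is a ranked poset of faces with ranks from $-1$ to $n$, with a unique least face (rank $-1$) and a unique greatest face (rank $n$), in which every flag (maximal chain) has $n+2$ faces, which satisfies the diamond condition (whenever $F<G$ with ranks $j-1$ and $j+1$ there are exactly two $j$-faces strictly between them), and which is strongly flag-connected (any two flags $\Phi,\Psi$ are joined by a sequence of flags, consecutive ones adjacent, all containing $\Phi\cap\Psi$; two flags are adjacent if they differ in exactly one face). $\Phi^j$ denotes the unique flag differing from $\Phi$ only in its $j$-face, and $\Phi^{i,j}=(\Phi^i)^j$. Each polytope considered has a fixed base flag $\Phi$. $\mathcal P$ is regular if its automorphism group $\Gamma(\mathcal P)$ is transitive on flags; then $\Gamma(\mathcal P)$ is generated by $\rho_0,\dots,\rho_{n-1}$, where $\rho_i$ maps $\Phi$ to $\Phi^i$. Put $\sigma_i=\rho_{i-1}\rho_i$ and $\Gamma^+(\mathcal P)=\langle\sigma_1,\dots,\sigma_{n-1}\rangle$; $\mathcal P$ is directly regular if it is regular and $\Gamma^+(\mathcal P)$ has index $2$ in $\Gamma(\mathcal P)$. $\mathcal P$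 is chiral if $\Gamma(\mathcal P)$ has exactly two orbits on flags and adjacent flags lie in distinct orbits; then $\Gamma^+(\mathcal P):=\Gamma(\mathcal P)$ is generated by $\sigma_1,\dots,\sigma_{n-1}$, where $\sigma_i$ maps $\Phi$ to $\Phi^{i,i-1}$. In both cases $(\sigma_i\cdots\sigma_j)^2=1$ for $i<j$. Let $W^+=\langle \sigma_1,\dots,\sigma_{n-1}\mid (\sigma_i\cdots\sigma_j)^2=1 \text{ for } 1\le i<j\le n-1\rangle$. Writing $\Gamma^+(\mathcal P)=W^+/M$ means that $M$ is the kernel of the epimorphism $W^+\to\Gamma^+(\mathcal P)$ preserving the specified generators. For $w\in W^+$, $\overline w$ is obtained by replacing $\sigma_1$ by $\sigma_1^{-1}$, $\sigma_2$ by $\sigma_1^2\sigma_2$ and fixing $\sigma_j$ for $j\ge3$; $\delta(w)$ is obtained by replacing each $\sigma_i$ by $\sigma_{n-i}^{-1}$ (both are automorphisms of $W^+$). For $M\trianglelefteq W^+$ put $\overline M=\{\overline w: w\in M\}$, $\delta(M)=\{\delta(w):w\in M\}$; one has $\delta(\overline M)=\overline{\delta(M)}$. If $\Gamma^+(\mathcal P)=W^+/M$, then the dual $\mathcal P^\delta$ (reversed partial order) has $\Gamma^+(\mathcal P^\delta)=W^+/\delta(M)$; $\mathcal P$ is directly regular if $\overline M=M$ and chiral otherwise; and the mirror image $\overline{\mathcal P}$ of a chiral $\mathcal P$ (same faces, base flag $\Phi^0$) has $\Gamma^+(\overline{\mathcal P})=W^+/\overline M$. Mix: $\mathcal P\diamond\mathcal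 Q$ denotes the flag-connected pre-polytope (polytope axioms with strong flag-connectedness weakened to flag-connectedness) built from the group $\Gamma^+(\mathcal P)\diamond\Gamma^+(\mathcal Q)$, the subgroup of $\Gamma^+(\mathcal P)\times\Gamma^+(\mathcal Q)$ with specified generators $\beta_i=(\sigma_i,\sigma_i')$. It is handled through its rotation group $\Gamma^+(\mathcal P\diamond\mathcal Q)=\Gamma^+(\mathcal P)\diamond\Gamma^+(\mathcal Q)=W^+/N$: it is directly regular if $\overline N=N$ and chiral otherwise; equality of two such structures means equality of the corresponding normal subgroups of $W^+$, and dual and mirror image correspond to $\delta(N)$ and $\overline N$. Such a structure is properly self-dual if $\delta(N)=N$ (equivalently there is a duality, i.e. order-reversing bijection, fixing the base flag); a chiral one is improperly self-dual if $\delta(N)=\overline N$ (it is self-dual, but no duality fixes the base flag). *)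

theory Defs
  imports "HOL-Algebra.Group_Action" "HOL-Algebra.Generated_Groups"
begin

section \<open>Abstract polytopes with a base flag\<close>

record 'a based_poset =
  face_le :: "'a rel"
  rk :: "'a \<Rightarrow> int"
  base :: "'a set"

definition faces :: "'a based_poset \<Rightarrow> 'a set" where
  "faces P = Field (face_le P)"

definition face_less :: "'a based_poset \<Rightarrow> 'a \<Rightarrow> 'a \<Rightarrow> bool" where
  "face_less P F G \<longleftrightarrow> (F, G) \<in> face_le P \<and> F \<noteq> G"

definition flags :: "'a based_poset \<Rightarrow> 'a set set" where
  "flags P = {C \<in> Chains (face_le P). \<forall>D \<in> Chains (face_le P). C \<subseteq> D \<longrightarrow> C = D}"

definition adjacent :: "'a set \<Rightarrow> 'a set \<Rightarrow> bool" where
  "adjacent A B \<longleftrightarrow> card (A - B) = 1 \<and> card (B - A) = 1"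

definition strongly_flag_connected :: "'a based_poset \<Rightarrow> bool" where
  "strongly_flag_connected P \<longleftrightarrow>
     (\<forall>\<Phi> \<in> flags P. \<forall>\<Psi> \<in> flags P.
        (\<Phi>, \<Psi>) \<in> {(A, B). A \<in> flags P \<and> B \<in> flags P \<and> adjacent A B \<and>
                        \<Phi> \<inter> \<Psi> \<subseteq> A \<and> \<Phi> \<inter> \<Psi> \<subseteq> B}\<^sup>*)"

text \<open>Together with the flag condition, strict monotonicity of the rank function forces each
  flag to contain exactly one face of each rank, so ranks increase by one along covers.\<close>

definition polytope :: "nat \<Rightarrow> 'a based_poset \<Rightarrow> bool" where
  "polytope n P \<longleftrightarrow>
     Partial_order (face_le P) \<and>
     (\<forall>F \<in> faces P. - 1 \<le> rk P F \<and> rk P F \<le> int n) \<and>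
     (\<forall>F G. face_less P F G \<longrightarrow> rk P F < rk P G) \<and>
     (\<exists>!F. F \<in> faces P \<and> rk P F = - 1 \<and> (\<forall>G \<in> faces P. (F, G) \<in> face_le P)) \<and>
     (\<exists>!F. F \<in> faces P \<and> rk P F = int n \<and> (\<forall>G \<in> faces P. (G, F) \<in> face_le P)) \<and>
     (\<forall>\<Psi> \<in> flags P. card \<Psi> = n + 2) \<and>
     (\<forall>F G. face_less P F G \<and> rk P G = rk P F + 2 \<longrightarrow>
        card {H. rk P H = rk P F + 1 \<and> face_less P F H \<and> face_less P H G} = 2) \<and>
     strongly_flag_connected P \<and>
     base P \<in> flags P"

definition flag_adj :: "'a based_poset \<Rightarrow> nat \<Rightarrow> 'a set \<Rightarrow> 'a set" where
  "flag_adj P j \<Psi> =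
     (THE \<Psi>'. \<Psi>' \<in> flags P \<and> \<Psi>' \<noteq> \<Psi> \<and>
        {F \<in> \<Psi>'. rk P F \<noteq> int j} = {F \<in> \<Psi>. rk P F \<noteq> int j})"

definition dual :: "nat \<Rightarrow> 'a based_poset \<Rightarrow> 'a based_poset" where
  "dual n P = \<lparr>face_le = (face_le P)\<inverse>, rk = (\<lambda>F. int n - 1 - rk P F), base = base P\<rparr>"

definition mirror :: "'a based_poset \<Rightarrow> 'a based_poset" where
  "mirror P = P\<lparr>base := flag_adj P 0 (base P)\<rparr>"


section \<open>Automorphism groups and rotation groups\<close>

text \<open>Automorphisms act on the right: the product \<open>f \<otimes> g\<close> is \<open>f\<close> followed by \<open>g\<close>. Under this
  convention \<open>\<rho>\<^bsub>i-1\<^esub>\<rho>\<^bsub>i\<^esub>\<close> maps the base flag \<open>\<Phi>\<close> to \<open>\<Phi>\<^bsup>i,i-1\<^esup>\<close>, in agreement with the chiral case.\<close>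

definition aut_group :: "'a based_poset \<Rightarrow> ('a \<Rightarrow> 'a) monoid" where
  "aut_group P =
     \<lparr>carrier = {f \<in> Bij (faces P). \<forall>F \<in> faces P. \<forall>G \<in> faces P.
                   (F, G) \<in> face_le P \<longleftrightarrow> (f F, f G) \<in> face_le P},
      monoid.mult = (\<lambda>f g. compose (faces P) g f),
      one = (\<lambda>F \<in> faces P. F)\<rparr>"

definition regular :: "'a based_poset \<Rightarrow> bool" where
  "regular P \<longleftrightarrow>
     (\<forall>\<Phi> \<in> flags P. \<forall>\<Psi> \<in> flags P. \<exists>f \<in> carrier (aut_group P). f ` \<Phi> = \<Psi>)"

definition base_to :: "'a based_poset \<Rightarrow> 'a set \<Rightarrow> 'a \<Rightarrow> 'a" where
  "base_to P \<Psi> = (THE f. f \<in> carrier (aut_group P) \<and> f ` base P = \<Psi>)"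

definition rho :: "'a based_poset \<Rightarrow> nat \<Rightarrow> 'a \<Rightarrow> 'a" where
  "rho P i = base_to P (flag_adj P i (base P))"

definition sigma :: "'a based_poset \<Rightarrow> nat \<Rightarrow> 'a \<Rightarrow> 'a" where
  "sigma P i =
     (if regular P then rho P (i - 1) \<otimes>\<^bsub>aut_group P\<^esub> rho P i
      else base_to P (flag_adj P (i - 1) (flag_adj P i (base P))))"

definition rot_group :: "nat \<Rightarrow> 'a based_poset \<Rightarrow> ('a \<Rightarrow> 'a) monoid" where
  "rot_group n P =
     (if regular P
      then (aut_group P)\<lparr>carrier := generate (aut_group P) (sigma P ` {1..<n})\<rparr>
      else aut_group P)"

definition directly_regular_polytope :: "nat \<Rightarrow> 'a based_poset \<Rightarrow> bool" where
  "directly_regular_polytope n P \<longleftrightarrow>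
     polytope n P \<and> regular P \<and>
     card (rcosets\<^bsub>aut_group P\<^esub> (carrier (rot_group n P))) = 2"

definition chiral_polytope :: "nat \<Rightarrow> 'a based_poset \<Rightarrow> bool" where
  "chiral_polytope n P \<longleftrightarrow>
     polytope n P \<and>
     card (orbits (aut_group P) (flags P) (`)) = 2 \<and>
     (\<forall>A \<in> flags P. \<forall>B \<in> flags P. adjacent A B \<longrightarrow>
        orbit (aut_group P) (`) A \<noteq> orbit (aut_group P) (`) B)"


section \<open>Groups given by generators and relations\<close>

text \<open>The letter \<open>(i, True)\<close> stands for the \<open>i\<close>-th generator and \<open>(i, False)\<close> for its inverse.\<close>

type_synonym word = "(nat \<times> bool) list"

definition words :: "nat set \<Rightarrow> word set" where
  "words I = lists (I \<times> UNIV)"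

inductive_set pres_rel :: "nat set \<Rightarrow> word set \<Rightarrow> word rel"
  for I :: "nat set" and R :: "word set"
where
  pres_refl: "u \<in> words I \<Longrightarrow> (u, u) \<in> pres_rel I R"
| pres_sym: "(u, v) \<in> pres_rel I R \<Longrightarrow> (v, u) \<in> pres_rel I R"
| pres_trans: "(u, v) \<in> pres_rel I R \<Longrightarrow> (v, w) \<in> pres_rel I R \<Longrightarrow> (u, w) \<in> pres_rel I R"
| pres_cancel: "u \<in> words I \<Longrightarrow> v \<in> words I \<Longrightarrow> i \<in> I \<Longrightarrow>
    (u @ [(i, b), (i, \<not> b)] @ v, u @ v) \<in> pres_rel I R"
| pres_relator: "u \<in> words I \<Longrightarrow> v \<in> words I \<Longrightarrow> r \<in> R \<Longrightarrow>
    (u @ r @ v, u @ v) \<in> pres_rel I R"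

definition presented_group :: "nat set \<Rightarrow> word set \<Rightarrow> word set monoid" where
  "presented_group I R =
     \<lparr>carrier = words I // pres_rel I R,
      monoid.mult = (\<lambda>A B. \<Union>u \<in> A. \<Union>v \<in> B. pres_rel I R `` {u @ v}),
      one = pres_rel I R `` {[]}\<rparr>"

definition word_eval :: "('g, 'm) monoid_scheme \<Rightarrow> (nat \<Rightarrow> 'g) \<Rightarrow> word \<Rightarrow> 'g" where
  "word_eval G g w =
     foldr (\<lambda>(i, b) x. (if b then g i else inv\<^bsub>G\<^esub> (g i)) \<otimes>\<^bsub>G\<^esub> x) w \<one>\<^bsub>G\<^esub>"

text \<open>The homomorphism from a presented group to \<open>G\<close> that sends the \<open>i\<close>-th generator to \<open>g i\<close>;
  it is meaningful when the elements \<open>g i\<close> satisfy the relations, so that \<open>word_eval G g\<close> is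
  constant on each class of words.\<close>

definition gen_hom :: "('g, 'm) monoid_scheme \<Rightarrow> (nat \<Rightarrow> 'g) \<Rightarrow> word set \<Rightarrow> 'g" where
  "gen_hom G g A = the_elem (word_eval G g ` A)"


section \<open>The group $W^+$\<close>

definition W_relators :: "nat \<Rightarrow> word set" where
  "W_relators n =
     {concat (replicate 2 (map (\<lambda>k. (k, True)) [i..<Suc j])) | i j. 1 \<le> i \<and> i < j \<and> j < n}"

definition W :: "nat \<Rightarrow> word set monoid" where
  "W n = presented_group {1..<n} (W_relators n)"

definition W_gen :: "nat \<Rightarrow> nat \<Rightarrow> word set" where
  "W_gen n i = pres_rel {1..<n} (W_relators n) `` {[(i, True)]}"

definition W_bar :: "nat \<Rightarrow> word set \<Rightarrow> word set" where
  "W_bar n = gen_hom (W n)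
     (\<lambda>i. if i = 1 then inv\<^bsub>W n\<^esub> (W_gen n 1)
          else if i = 2 then W_gen n 1 [^]\<^bsub>W n\<^esub> (2::nat) \<otimes>\<^bsub>W n\<^esub> W_gen n 2
          else W_gen n i)"

definition W_delta :: "nat \<Rightarrow> word set \<Rightarrow> word set" where
  "W_delta n = gen_hom (W n) (\<lambda>i. inv\<^bsub>W n\<^esub> (W_gen n (n - i)))"


section \<open>Mixes\<close>

definition mix_gen :: "'a based_poset \<Rightarrow> 'b based_poset \<Rightarrow> nat \<Rightarrow> ('a \<Rightarrow> 'a) \<times> ('b \<Rightarrow> 'b)" where
  "mix_gen P Q i = (sigma P i, sigma Q i)"

definition mix_group ::
  "nat \<Rightarrow> 'a based_poset \<Rightarrow> 'b based_poset \<Rightarrow> (('a \<Rightarrow> 'a) \<times> ('b \<Rightarrow> 'b)) monoid" where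
  "mix_group n P Q =
     (rot_group n P \<times>\<times> rot_group n Q)
       \<lparr>carrier := generate (rot_group n P \<times>\<times> rot_group n Q) (mix_gen P Q ` {1..<n})\<rparr>"

text \<open>The mix of two polytopes is a pre-polytope that is determined by its rotation group
  \<open>W\<^sup>+ / N\<close>; it is represented here by the normal subgroup \<open>N\<close> of \<open>W\<^sup>+\<close>. The predicates and
  operations below are those of such structures, with \<open>N\<close> standing for the structure.\<close>

definition mix :: "nat \<Rightarrow> 'a based_poset \<Rightarrow> 'b based_poset \<Rightarrow> word set set" where
  "mix n P Q = kernel (W n) (mix_group n P Q) (gen_hom (mix_group n P Q) (mix_gen P Q))"

definition struct_mirror :: "nat \<Rightarrow> word set set \<Rightarrow> word set set" where
  "struct_mirror n N = W_bar n ` N"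

definition struct_dual :: "nat \<Rightarrow> word set set \<Rightarrow> word set set" where
  "struct_dual n N = W_delta n ` N"

definition struct_directly_regular :: "nat \<Rightarrow> word set set \<Rightarrow> bool" where
  "struct_directly_regular n N \<longleftrightarrow> struct_mirror n N = N"

definition struct_chiral :: "nat \<Rightarrow> word set set \<Rightarrow> bool" where
  "struct_chiral n N \<longleftrightarrow> \<not> struct_directly_regular n N"

definition properly_self_dual :: "nat \<Rightarrow> word set set \<Rightarrow> bool" where
  "properly_self_dual n N \<longleftrightarrow> struct_dual n N = N"

definition improperly_self_dual :: "nat \<Rightarrow> word set set \<Rightarrow> bool" where
  "improperly_self_dual n N \<longleftrightarrow> struct_chiral n N \<and> struct_dual n N = struct_mirror n N"

end

theory Submission
  imports Defs
begin

text \<open>Let \<open>a\<^sub>j\<close> send a flag to its \<open>j\<close>-adjacent flag. A word in the \<open>\<sigma>\<^sub>i\<close> acts on flags by replacing \<open>\<sigma>\<^sub>i\<close> by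
  \<open>a\<^bsub>i-1\<^esub> a\<^sub>i\<close>; this action commutes with all automorphisms, and automorphisms act freely on flags,
  so a word is trivial in the rotation group iff it fixes the base flag. Passing to the dual
  replaces a word \<open>w\<close> by \<open>\<delta>(w)\<close>, and moving the base flag to its \<open>0\<close>-adjacent flag replaces \<open>w\<close> by
  its bar, the conjugate of \<open>w\<close> by \<open>a\<^sub>0\<close>. Hence, with \<open>K\<close> the kernel belonging to \<open>P\<close>, the first mix is
  \<open>K \<inter> \<delta>(K)\<close>, which is invariant under the involution \<open>\<delta>\<close>. The second mix is the set of \<open>w \<in> K\<close>
  whose dual word fixes the \<open>(n-1)\<close>-adjacent flag of the base flag; if \<open>P\<close> is chiral, that flag lies
  in the same orbit as the \<open>0\<close>-adjacent one, so bar and \<open>\<delta>\<close> may be applied in either order.\<close>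

section \<open>Presented groups\<close>

definition inv_word :: "word \<Rightarrow> word" where
  "inv_word w = rev (map (\<lambda>(i, b). (i, \<not> b)) w)"

text \<open>Substitution on representatives: it computes in words the homomorphism that sends the
  generator \<open>i\<close> to the class of \<open>h i\<close>.\<close>

definition subst_word :: "(nat \<Rightarrow> word) \<Rightarrow> word \<Rightarrow> word" where
  "subst_word h w = concat (map (\<lambda>(i, b). if b then h i else inv_word (h i)) w)"

lemma words_Nil [simp]: "[] \<in> words I"
  and words_Cons [simp]: "x # w \<in> words I \<longleftrightarrow> fst x \<in> I \<and> w \<in> words I"
  and words_append [simp]: "u @ v \<in> words I \<longleftrightarrow> u \<in> words I \<and> v \<in> words I"
  by (cases x; auto simp: words_def)+

lemma inv_word_simps [simp]:
  "inv_word [] = []" "inv_word ((i, b) # w) = inv_word w @ [(i, \<not> b)]"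
  by (auto simp: inv_word_def)

lemma inv_word_append [simp]: "inv_word (u @ v) = inv_word v @ inv_word u"
  by (simp add: inv_word_def)

lemma inv_word_in_words [simp]: "inv_word w \<in> words I \<longleftrightarrow> w \<in> words I"
  by (induction w) auto

lemma subst_word_simps [simp]:
  "subst_word h [] = []"
  "subst_word h ((i, b) # w) = (if b then h i else inv_word (h i)) @ subst_word h w"
  by (auto simp: subst_word_def)

lemma subst_word_in_words:
  assumes "w \<in> words I" and "\<And>i. i \<in> I \<Longrightarrow> h i \<in> words J"
  shows "subst_word h w \<in> words J"
  using assms(1) by (induction w) (auto simp: assms(2))

lemma pres_rel_in_words:
  assumes "(u, v) \<in> pres_rel I R" and "R \<subseteq> words I"
  shows "u \<in> words I \<and> v \<in> words I"
  using assms by (induction rule: pres_rel.induct) auto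

lemma equiv_pres_rel:
  assumes "R \<subseteq> words I"
  shows "equiv (words I) (pres_rel I R)"
proof (rule equivI)
  show "pres_rel I R \<subseteq> words I \<times> words I"
    using pres_rel_in_words[OF _ assms] by auto
  show "refl_on (words I) (pres_rel I R)"
    by (auto simp: refl_on_def intro: pres_refl)
  show "sym (pres_rel I R)" by (auto intro: symI pres_sym)
  show "trans (pres_rel I R)" by (auto intro: transI pres_trans)
qed

text \<open>The context \<open>p\<close>, \<open>q\<close> is absorbed into the outer words that the
  cancellation and relator rules already carry. This makes the relation a congruence for
  concatenation.\<close>

lemma pres_rel_append_context:
  assumes "(u, v) \<in> pres_rel I R" and "p \<in> words I" and "q \<in> words I"
  shows "(p @ u @ q, p @ v @ q) \<in> pres_rel I R"
  using assms(1)
proof (induction rule: pres_rel.induct)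
  case (pres_refl u)
  then show ?case using assms by (auto intro: pres_rel.pres_refl)
next
  case (pres_cancel u v i b)
  then show ?case
    using assms pres_rel.pres_cancel[of "p @ u" I "v @ q" i b R] by simp
next
  case (pres_relator u v r)
  then show ?case
    using assms pres_rel.pres_relator[of "p @ u" I "v @ q" r R] by simp
qed (auto intro: pres_rel.pres_sym pres_rel.pres_trans)

lemma pres_rel_append:
  assumes "R \<subseteq> words I" and "(u, u') \<in> pres_rel I R" and "(v, v') \<in> pres_rel I R"
  shows "(u @ v, u' @ v') \<in> pres_rel I R"
proof -
  have "(u @ v, u' @ v) \<in> pres_rel I R"
    using pres_rel_append_context[OF assms(2), of "[]" v] pres_rel_in_words[OF assms(3,1)] by simp
  moreover have "(u' @ v, u' @ v') \<in> pres_rel I R"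
    using pres_rel_append_context[OF assms(3), of u' "[]"] pres_rel_in_words[OF assms(2,1)] by simp
  ultimately show ?thesis by (rule pres_trans)
qed

lemma pres_rel_inv_word:
  assumes "w \<in> words I"
  shows "(inv_word w @ w, []) \<in> pres_rel I R"
  using assms
proof (induction w)
  case Nil
  then show ?case by (auto intro: pres_refl)
next
  case (Cons x w)
  obtain i b where x: "x = (i, b)" by force
  have "(inv_word w @ [(i, \<not> b), (i, \<not> \<not> b)] @ w, inv_word w @ w) \<in> pres_rel I R"
    using Cons x by (intro pres_cancel) auto
  then show ?case using Cons x by (auto intro: pres_trans)
qed

section \<open>The group structure on classes of words\<close>

lemma presented_group_carrier:
  "carrier (presented_group I R) = words I // pres_rel I R"
  by (simp add: presented_group_def)

lemma presented_group_one: "\<one>\<^bsub>presented_group I R\<^esub> = pres_rel I R `` {[]}"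
  by (simp add: presented_group_def)

lemma class_in_carrier:
  "w \<in> words I \<Longrightarrow> pres_rel I R `` {w} \<in> carrier (presented_group I R)"
  by (auto simp: presented_group_def intro: quotientI)

lemma class_cases:
  assumes "c \<in> carrier (presented_group I R)"
  obtains w where "w \<in> words I" and "c = pres_rel I R `` {w}"
  using assms by (auto simp: presented_group_def elim: quotientE)

lemma class_eq_iff:
  assumes "R \<subseteq> words I" and "u \<in> words I" and "v \<in> words I"
  shows "pres_rel I R `` {u} = pres_rel I R `` {v} \<longleftrightarrow> (u, v) \<in> pres_rel I R"
  using eq_equiv_class_iff[OF equiv_pres_rel[OF assms(1)]] assms by simp

text \<open>The product is a union over all pairs of representatives; by the congruence property
  every member of that union is the same class, so it collapses.\<close>

lemma class_mult:
  assumes R: "R \<subseteq> words I" and u: "u \<in> words I" and v: "v \<in> words I"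
  shows "pres_rel I R `` {u} \<otimes>\<^bsub>presented_group I R\<^esub> pres_rel I R `` {v} = pres_rel I R `` {u @ v}"
proof -
  have "(\<Union>u' \<in> pres_rel I R `` {u}. \<Union>v' \<in> pres_rel I R `` {v}. pres_rel I R `` {u' @ v'})
      = (\<Union>u' \<in> pres_rel I R `` {u}. \<Union>v' \<in> pres_rel I R `` {v}. pres_rel I R `` {u @ v})"
  proof (intro SUP_cong refl)
    fix u' v' assume "u' \<in> pres_rel I R `` {u}" "v' \<in> pres_rel I R `` {v}"
    then have "(u @ v, u' @ v') \<in> pres_rel I R" by (intro pres_rel_append[OF R]) auto
    then show "pres_rel I R `` {u' @ v'} = pres_rel I R `` {u @ v}"
      by (metis equiv_class_eq[OF equiv_pres_rel[OF R]])
  qed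
  moreover have "u \<in> pres_rel I R `` {u}" "v \<in> pres_rel I R `` {v}"
    using u v by (auto intro: pres_refl)
  ultimately show ?thesis by (auto simp: presented_group_def)
qed

text \<open>A left identity and left inverses suffice; the class of the formal inverse word is a
  left inverse.\<close>

lemma group_presented_group:
  assumes R: "R \<subseteq> words I"
  shows "group (presented_group I R)"
proof (rule groupI)
  show "\<one>\<^bsub>presented_group I R\<^esub> \<in> carrier (presented_group I R)"
    by (simp add: presented_group_one class_in_carrier)
next
  fix x y assume "x \<in> carrier (presented_group I R)" "y \<in> carrier (presented_group I R)"
  then show "x \<otimes>\<^bsub>presented_group I R\<^esub> y \<in> carrier (presented_group I R)"
    by (elim class_cases) (simp add: class_mult[OF R] class_in_carrier)
next
  fix x y z assume "x \<in> carrier (presented_group I R)" "y \<in> carrier (presented_group I R)"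
    "z \<in> carrier (presented_group I R)"
  then show "x \<otimes>\<^bsub>presented_group I R\<^esub> y \<otimes>\<^bsub>presented_group I R\<^esub> z =
      x \<otimes>\<^bsub>presented_group I R\<^esub> (y \<otimes>\<^bsub>presented_group I R\<^esub> z)"
    by (elim class_cases) (simp add: class_mult[OF R])
next
  fix x assume "x \<in> carrier (presented_group I R)"
  then show "\<one>\<^bsub>presented_group I R\<^esub> \<otimes>\<^bsub>presented_group I R\<^esub> x = x"
    by (elim class_cases) (simp add: presented_group_one class_mult[OF R])
next
  fix x assume "x \<in> carrier (presented_group I R)"
  then obtain w where w: "w \<in> words I" and x: "x = pres_rel I R `` {w}" by (rule class_cases)
  have "pres_rel I R `` {inv_word w} \<otimes>\<^bsub>presented_group I R\<^esub> x = \<one>\<^bsub>presented_group I R\<^esub>"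
    using w by (simp add: x class_mult[OF R] presented_group_one class_eq_iff[OF R] pres_rel_inv_word)
  then show "\<exists>y\<in>carrier (presented_group I R). y \<otimes>\<^bsub>presented_group I R\<^esub> x = \<one>\<^bsub>presented_group I R\<^esub>"
    using w class_in_carrier by fastforce
qed

lemma class_inv:
  assumes R: "R \<subseteq> words I" and w: "w \<in> words I"
  shows "inv\<^bsub>presented_group I R\<^esub> (pres_rel I R `` {w}) = pres_rel I R `` {inv_word w}"
proof -
  interpret group "presented_group I R" by (rule group_presented_group[OF R])
  show ?thesis
    using w by (intro inv_equality)
      (auto simp: class_mult[OF R] presented_group_one class_eq_iff[OF R] pres_rel_inv_word class_in_carrier)
qed

section \<open>Evaluation of words and homomorphisms out of a presented group\<close>

lemma word_eval_simps [simp]: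
  "word_eval G g [] = \<one>\<^bsub>G\<^esub>"
  "word_eval G g ((i, b) # w) = (if b then g i else inv\<^bsub>G\<^esub> (g i)) \<otimes>\<^bsub>G\<^esub> word_eval G g w"
  by (auto simp: word_eval_def)

lemma word_eval_cong:
  "w \<in> words I \<Longrightarrow> (\<And>i. i \<in> I \<Longrightarrow> g i = h i) \<Longrightarrow> word_eval G g w = word_eval G h w"
  by (induction w) auto

text \<open>Gives explicit representatives for the images under \<open>gen_hom\<close> when the
  target is itself a presented group.\<close>

lemma word_eval_presented_group:
  assumes R: "R \<subseteq> words J" and h: "\<And>i. i \<in> I \<Longrightarrow> h i \<in> words J" and w: "w \<in> words I"
  shows "word_eval (presented_group J R) (\<lambda>i. pres_rel J R `` {h i}) w
       = pres_rel J R `` {subst_word h w}"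
  using w
proof (induction w)
  case Nil
  then show ?case by (simp add: presented_group_one)
next
  case (Cons x w)
  obtain i b where x: "x = (i, b)" by force
  then have "h i \<in> words J" "subst_word h w \<in> words J"
    using Cons.prems h by (auto intro: subst_word_in_words)
  then show ?case using Cons x by (auto simp: class_mult[OF R] class_inv[OF R])
qed

lemma (in group) word_eval_closed:
  assumes "w \<in> words I" and "\<And>i. i \<in> I \<Longrightarrow> g i \<in> carrier G"
  shows "word_eval G g w \<in> carrier G"
  using assms(1) by (induction w) (auto simp: assms(2))

lemma (in group) word_eval_append:
  assumes "u \<in> words I" and "v \<in> words I" and g: "\<And>i. i \<in> I \<Longrightarrow> g i \<in> carrier G"
  shows "word_eval G g (u @ v) = word_eval G g u \<otimes> word_eval G g v"
  using assms(1)
proof (induction u)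
  case Nil
  then show ?case using word_eval_closed[OF assms(2) g] by simp
next
  case (Cons x u)
  then show ?case
    using word_eval_closed[OF _ g, of u] word_eval_closed[OF assms(2) g] g
    by (cases x) (auto simp: m_assoc)
qed

text \<open>The word form of von Dyck's theorem: each generating step of the relation deletes a
  cancelling pair or a relator, and both evaluate to the identity.\<close>

lemma (in group) word_eval_pres_rel:
  assumes R: "R \<subseteq> words I" and g: "\<And>i. i \<in> I \<Longrightarrow> g i \<in> carrier G"
    and triv: "\<And>r. r \<in> R \<Longrightarrow> word_eval G g r = \<one>"
    and uv: "(u, v) \<in> pres_rel I R"
  shows "word_eval G g u = word_eval G g v"
  using uv
proof (induction rule: pres_rel.induct)
  case (pres_cancel u v i b)
  have "word_eval G g ((i, b) # (i, \<not> b) # v) = word_eval G g v"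
    using g[OF pres_cancel(3)] word_eval_closed[OF pres_cancel(2) g]
    by (auto simp flip: m_assoc)
  then show ?case using pres_cancel g
    by (simp add: word_eval_append[where I = I] del: word_eval_simps)
next
  case (pres_relator u v r)
  then have "r \<in> words I" using R by auto
  with pres_relator show ?case
    using triv g word_eval_closed[OF pres_relator(2) g]
    by (simp add: word_eval_append[where I = I])
qed auto

text \<open>Evaluation is constant on the class, so its image is a singleton and
  \<open>the_elem\<close> in \<open>gen_hom\<close> returns a genuine value.\<close>

lemma (in group) gen_hom_class:
  assumes R: "R \<subseteq> words I" and g: "\<And>i. i \<in> I \<Longrightarrow> g i \<in> carrier G"
    and triv: "\<And>r. r \<in> R \<Longrightarrow> word_eval G g r = \<one>" and w: "w \<in> words I"
  shows "gen_hom G g (pres_rel I R `` {w}) = word_eval G g w"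
proof -
  have "word_eval G g ` (pres_rel I R `` {w}) = {word_eval G g w}"
    using word_eval_pres_rel[OF R g triv] pres_refl[OF w] by fastforce
  then show ?thesis by (simp add: gen_hom_def)
qed

lemma (in group) word_eval_subgroup:
  assumes H: "subgroup H G" and g: "\<And>i. i \<in> I \<Longrightarrow> g i \<in> H" and w: "w \<in> words I"
  shows "word_eval (G\<lparr>carrier := H\<rparr>) g w = word_eval G g w"
  using w by (induction w) (auto simp: m_inv_consistent[OF H] g)

lemma word_eval_DirProd:
  assumes "group G" and "group H" and w: "w \<in> words I"
    and "\<And>i. i \<in> I \<Longrightarrow> g i \<in> carrier G" and "\<And>i. i \<in> I \<Longrightarrow> h i \<in> carrier H"
  shows "word_eval (G \<times>\<times> H) (\<lambda>i. (g i, h i)) w = (word_eval G g w, word_eval H h w)"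
  using w by (induction w) (auto simp: inv_DirProd assms)

section \<open>The automorphisms of \<open>W\<^sup>+\<close>\<close>

declare One_nat_def [simp del]

abbreviation W_class :: "nat \<Rightarrow> word \<Rightarrow> word set" where
  "W_class n w \<equiv> pres_rel {1..<n} (W_relators n) `` {w}"

definition bar_word :: "word \<Rightarrow> word" where
  "bar_word = subst_word (\<lambda>i. if i = 1 then [(1, False)]
     else if i = 2 then [(1, True), (1, True), (2, True)] else [(i, True)])"

text \<open>The order of the letters is kept, because delta is an automorphism; only the single
  letters are inverted.\<close>

definition delta_word :: "nat \<Rightarrow> word \<Rightarrow> word" where
  "delta_word n = map (\<lambda>(i, b). (n - i, \<not> b))"

text \<open>The word sigma_i ... sigma_j. The squares of the runs with \<open>i < j\<close> are the
  relators.\<close>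

definition run :: "nat \<Rightarrow> nat \<Rightarrow> word" where
  "run i j = map (\<lambda>k. (k, True)) [i..<Suc j]"

lemma W_relators_run: "W_relators n = {run i j @ run i j | i j. 1 \<le> i \<and> i < j \<and> j < n}"
  by (auto simp: W_relators_def run_def numeral_2_eq_2)

lemma run_in_words: "1 \<le> i \<Longrightarrow> j < n \<Longrightarrow> run i j \<in> words {1..<n}"
  by (auto simp: run_def words_def)

lemma run_rec: "i \<le> j \<Longrightarrow> run i j = (i, True) # run (Suc i) j"
  by (simp add: run_def upt_rec)

lemma W_relators_in_words: "W_relators n \<subseteq> words {1..<n}"
  using run_in_words by (auto simp: W_relators_run)

lemma group_W: "group (W n)"
  unfolding W_def by (rule group_presented_group[OF W_relators_in_words])

lemma W_class_mult:
  "u \<in> words {1..<n} \<Longrightarrow> v \<in> words {1..<n} \<Longrightarrow> W_class n u \<otimes>\<^bsub>W n\<^esub> W_class n v = W_class n (u @ v)"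
  unfolding W_def by (rule class_mult[OF W_relators_in_words])

lemma W_class_inv:
  "w \<in> words {1..<n} \<Longrightarrow> inv\<^bsub>W n\<^esub> (W_class n w) = W_class n (inv_word w)"
  unfolding W_def by (rule class_inv[OF W_relators_in_words])

lemma W_class_in_carrier: "w \<in> words {1..<n} \<Longrightarrow> W_class n w \<in> carrier (W n)"
  unfolding W_def by (rule class_in_carrier)

lemma W_one: "\<one>\<^bsub>W n\<^esub> = W_class n []"
  by (simp add: W_def presented_group_one)

lemma W_gen_in_carrier: "i \<in> {1..<n} \<Longrightarrow> W_gen n i \<in> carrier (W n)"
  unfolding W_gen_def by (rule W_class_in_carrier) auto

lemma W_run_square:
  assumes "1 \<le> i" and "i < j" and "j < n"
  shows "W_class n (run i j) \<otimes>\<^bsub>W n\<^esub> W_class n (run i j) = \<one>\<^bsub>W n\<^esub>"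
proof -
  have "run i j @ run i j \<in> W_relators n" using assms by (auto simp: W_relators_run)
  then have "(run i j @ run i j, []) \<in> pres_rel {1..<n} (W_relators n)"
    using pres_relator[of "[]" "{1..<n}" "[]" "run i j @ run i j"] by simp
  then show ?thesis
    using assms by (simp add: W_class_mult run_in_words W_one
        class_eq_iff[OF W_relators_in_words])
qed

lemma bar_word_simps [simp]:
  "bar_word [] = []" "bar_word (u @ v) = bar_word u @ bar_word v"
  by (auto simp: bar_word_def subst_word_def)

lemma bar_word_in_words: "w \<in> words {1..<n} \<Longrightarrow> bar_word w \<in> words {1..<n}"
  unfolding bar_word_def by (rule subst_word_in_words) (auto split: if_splits)

lemma delta_word_in_words: "w \<in> words {1..<n} \<Longrightarrow> delta_word n w \<in> words {1..<n}"
  by (induction w) (auto simp: delta_word_def)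

lemma delta_word_delta_word: "w \<in> words {1..<n} \<Longrightarrow> delta_word n (delta_word n w) = w"
  by (induction w) (auto simp: delta_word_def)

lemma delta_word_subst: "delta_word n = subst_word (\<lambda>i. [(n - i, False)])"
proof
  fix w show "delta_word n w = subst_word (\<lambda>i. [(n - i, False)]) w"
    by (induction w) (auto simp: delta_word_def)
qed

text \<open>The image sigma_{n-i}^-1 ... sigma_{n-j}^-1 is the inverse of sigma_{n-j} ...
  sigma_{n-i}. The first letter of the one run corresponds to the last letter of the other, which
  drives the induction.\<close>

lemma delta_word_run: "n > j \<Longrightarrow> 1 \<le> i \<Longrightarrow> delta_word n (run i j) = inv_word (run (n - j) (n - i))"
proof (induction "Suc j - i" arbitrary: i)
  case 0
  then show ?case by (simp add: run_def delta_word_def)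
next
  case (Suc k)
  have "run (n - j) (n - i) = run (n - j) (n - Suc i) @ [(n - i, True)]"
    using Suc by (simp add: run_def Suc_diff_Suc)
  then show ?case using Suc(1)[of "Suc i"] Suc(2-) by (simp add: run_rec delta_word_def)
qed

section \<open>Delta and bar computed on representatives\<close>

text \<open>The point is that delta respects the relators: the square of a run goes to the inverse
  of the square of the reflected run, hence to the identity.\<close>

lemma W_delta_class:
  assumes w: "w \<in> words {1..<n}"
  shows "W_delta n (W_class n w) = W_class n (delta_word n w)"
proof -
  interpret group "W n" by (rule group_W)
  define g where "g i = inv\<^bsub>W n\<^esub> (W_gen n (n - i))" for i
  have g: "g i = W_class n [(n - i, False)]" if "i \<in> {1..<n}" for i
  proof -
    have "[(n - i, True)] \<in> words {1..<n}" using that by auto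
    from W_class_inv[OF this] show ?thesis by (simp add: g_def W_gen_def)
  qed
  have gc: "g i \<in> carrier (W n)" if "i \<in> {1..<n}" for i
    using that by (simp only: g) (intro W_class_in_carrier, auto)
  have ev: "word_eval (W n) g w = W_class n (delta_word n w)" if "w \<in> words {1..<n}" for w
  proof -
    have "word_eval (W n) g w = word_eval (W n) (\<lambda>i. W_class n [(n - i, False)]) w"
      using that g by (rule word_eval_cong)
    also have "\<dots> = W_class n (delta_word n w)"
      unfolding delta_word_subst W_def using that
      by (intro word_eval_presented_group[OF W_relators_in_words]) auto
    finally show ?thesis .
  qed
  have "word_eval (W n) g r = \<one>\<^bsub>W n\<^esub>" if "r \<in> W_relators n" for r
  proof -
    from that obtain i j where ij: "1 \<le> i" "i < j" "j < n" and r: "r = run i j @ run i j"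
      by (auto simp: W_relators_run)
    let ?x = "W_class n (run (n - j) (n - i))"
    have w: "run (n - j) (n - i) \<in> words {1..<n}" using ij by (intro run_in_words) auto
    have "word_eval (W n) g r = W_class n (delta_word n r)"
      using that W_relators_in_words by (intro ev) auto
    also have "delta_word n r = inv_word (run (n - j) (n - i) @ run (n - j) (n - i))"
      using ij delta_word_run[of j n i] by (simp add: r delta_word_def)
    also have "W_class n \<dots> = inv\<^bsub>W n\<^esub> (?x \<otimes>\<^bsub>W n\<^esub> ?x)"
      using w by (simp add: W_class_mult W_class_inv)
    also have "?x \<otimes>\<^bsub>W n\<^esub> ?x = \<one>\<^bsub>W n\<^esub>" using ij by (intro W_run_square) auto
    finally show ?thesis by simp
  qed
  then have "gen_hom (W n) g (W_class n w) = word_eval (W n) g w"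
    by (intro gen_hom_class[OF W_relators_in_words gc _ w])
  then show ?thesis using ev[OF w] by (simp add: W_delta_def g_def[abs_def])
qed

text \<open>Again the relators have to be respected. Only the first index of a run matters, since
  every generator from sigma_3 on is fixed.\<close>

lemma W_bar_class:
  assumes w: "w \<in> words {1..<n}"
  shows "W_bar n (W_class n w) = W_class n (bar_word w)"
proof -
  interpret group "W n" by (rule group_W)
  define g where "g i = (if i = 1 then inv\<^bsub>W n\<^esub> (W_gen n 1)
          else if i = 2 then W_gen n 1 [^]\<^bsub>W n\<^esub> (2::nat) \<otimes>\<^bsub>W n\<^esub> W_gen n 2
          else W_gen n i)" for i
  define h :: "nat \<Rightarrow> word" where "h i = (if i = 1 then [(1, False)]
     else if i = 2 then [(1, True), (1, True), (2, True)] else [(i, True)])" for i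
  have bar: "bar_word = subst_word h" by (simp add: bar_word_def h_def[abs_def])
  have h: "h i \<in> words {1..<n}" if "i \<in> {1..<n}" for i
    using that by (auto simp: h_def)
  have g: "g i = W_class n (h i)" if "i \<in> {1..<n}" for i
  proof -
    have "W_gen n 1 [^]\<^bsub>W n\<^esub> (2::nat) = W_class n [(1, True), (1, True)]"
      using that W_gen_in_carrier[of 1 n]
      by (simp add: numeral_2_eq_2 W_gen_def W_class_mult)
    then show ?thesis
      using that by (auto simp: g_def h_def W_gen_def W_class_inv W_class_mult)
  qed
  have gc: "g i \<in> carrier (W n)" if "i \<in> {1..<n}" for i
    using that by (simp only: g) (intro W_class_in_carrier h, auto)
  have ev: "word_eval (W n) g w = W_class n (bar_word w)" if "w \<in> words {1..<n}" for w
  proof -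
    have "word_eval (W n) g w = word_eval (W n) (\<lambda>i. W_class n (h i)) w"
      using that g by (rule word_eval_cong)
    also have "\<dots> = W_class n (bar_word w)"
      unfolding bar W_def using that h
      by (intro word_eval_presented_group[OF W_relators_in_words]) auto
    finally show ?thesis .
  qed
  have bar_run: "bar_word (run i j) = run i j" if "3 \<le> i" for i j
  proof -
    have "subst_word h (run i j) = run i j"
      using that
    proof (induction "Suc j - i" arbitrary: i)
      case (Suc k)
      then show ?case using Suc(1)[of "Suc i"] by (simp add: run_rec h_def)
    qed (simp add: run_def)
    then show ?thesis by (simp add: bar)
  qed
  have "word_eval (W n) g r = \<one>\<^bsub>W n\<^esub>" if "r \<in> W_relators n" for r
  proof -
    from that obtain i j where ij: "1 \<le> i" "i < j" "j < n" and r: "r = run i j @ run i j"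
      by (auto simp: W_relators_run)
    let ?x = "W_class n (bar_word (run i j))"
    have "?x \<otimes>\<^bsub>W n\<^esub> ?x = \<one>\<^bsub>W n\<^esub>"
    proof -
      let ?s = "W_class n [(1, True)]" and ?t = "W_class n (run 1 j)" and ?m = "W_class n (run 2 j)"
      have s: "?s \<in> carrier (W n)" "?t \<in> carrier (W n)" "?m \<in> carrier (W n)"
        using ij by (auto intro!: W_class_in_carrier run_in_words)
      have t: "?t = ?s \<otimes>\<^bsub>W n\<^esub> ?m"
        using ij run_in_words[of 2 j n] by (simp add: run_rec W_class_mult numeral_2_eq_2)
      have tt: "?t \<otimes>\<^bsub>W n\<^esub> ?t = \<one>\<^bsub>W n\<^esub>" using ij by (intro W_run_square) auto
      consider "i = 1" | "i = 2" | "3 \<le> i" using ij by linarith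
      then show ?thesis
      proof cases
        case 1
        \<comment> \<open>The image begins with sigma_1^-1 sigma_1^2 sigma_2, so one cancellation
          gives back the run itself.\<close>
        have "bar_word (run 1 j) = [] @ [(1, False), (1, \<not> False)] @ run 1 j"
          using ij bar_run[of 3 j]
          by (simp add: run_rec bar_word_def numeral_2_eq_2 numeral_3_eq_3)
        then have "?x = ?t"
          using ij 1 run_in_words[of 1 j n] bar_word_in_words[of "run 1 j" n]
            pres_cancel[of "[]" "{1..<n}" "run 1 j" 1 False "W_relators n"]
          by (simp add: class_eq_iff[OF W_relators_in_words])
        then show ?thesis using tt by simp
      next
        case 2
        have mm: "?m \<otimes>\<^bsub>W n\<^esub> ?m = \<one>\<^bsub>W n\<^esub>" using ij 2 by (intro W_run_square) auto
        have "bar_word (run 2 j) = [(1, True)] @ run 1 j"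
          using ij bar_run[of 3 j]
          by (simp add: run_rec bar_word_def numeral_2_eq_2 numeral_3_eq_3)
        \<comment> \<open>With \<open>?s\<close>, \<open>?m\<close> for sigma_1 and sigma_2 ...
          sigma_j, the image is s s m, and the goal is that s s m s s m is trivial.\<close>
        then have x: "?x = ?s \<otimes>\<^bsub>W n\<^esub> ?t"
          using ij 2 run_in_words[of 1 j n] by (simp add: W_class_mult)
        \<comment> \<open>As t = s m, the relation t t = 1 reads s m s m = 1, so m s m is the
          inverse of s.\<close>
        have "?s \<otimes>\<^bsub>W n\<^esub> (?m \<otimes>\<^bsub>W n\<^esub> ?s \<otimes>\<^bsub>W n\<^esub> ?m) = \<one>\<^bsub>W n\<^esub>"
          using tt s by (simp add: t m_assoc)
        then have "?m \<otimes>\<^bsub>W n\<^esub> ?s \<otimes>\<^bsub>W n\<^esub> ?m = inv\<^bsub>W n\<^esub> ?s"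
          using s by (metis inv_equality inv_inv m_closed)
        \<comment> \<open>Inserting m m = 1 between the two copies of s splits m s s m into two
          factors m s m, so it is s^-2.\<close>
        moreover have "?m \<otimes>\<^bsub>W n\<^esub> (?s \<otimes>\<^bsub>W n\<^esub> ?s) \<otimes>\<^bsub>W n\<^esub> ?m =
            (?m \<otimes>\<^bsub>W n\<^esub> ?s \<otimes>\<^bsub>W n\<^esub> ?m) \<otimes>\<^bsub>W n\<^esub> (?m \<otimes>\<^bsub>W n\<^esub> ?s \<otimes>\<^bsub>W n\<^esub> ?m)"
        proof -
          have "?m \<otimes>\<^bsub>W n\<^esub> (?m \<otimes>\<^bsub>W n\<^esub> (?s \<otimes>\<^bsub>W n\<^esub> ?m)) = ?s \<otimes>\<^bsub>W n\<^esub> ?m"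
            using s mm by (simp flip: m_assoc)
          then show ?thesis using s by (simp add: m_assoc)
        qed
        ultimately have "?s \<otimes>\<^bsub>W n\<^esub> ?s \<otimes>\<^bsub>W n\<^esub> (?m \<otimes>\<^bsub>W n\<^esub> (?s \<otimes>\<^bsub>W n\<^esub> ?s) \<otimes>\<^bsub>W n\<^esub> ?m) = \<one>\<^bsub>W n\<^esub>"
          using s by (simp add: inv_mult_group[symmetric])
        then show ?thesis using s by (simp add: x t m_assoc)
      next
        case 3
        then show ?thesis using ij by (simp only: bar_run) (intro W_run_square, auto)
      qed
    qed
    moreover have "word_eval (W n) g r = W_class n (bar_word r)"
      using that W_relators_in_words by (intro ev) auto
    ultimately show ?thesis
      using ij by (simp add: r W_class_mult bar_word_in_words run_in_words)
  qed
  then have "gen_hom (W n) g (W_class n w) = word_eval (W n) g w"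
    by (intro gen_hom_class[OF W_relators_in_words gc _ w])
  then show ?thesis using ev[OF w] by (simp add: W_bar_def g_def[abs_def])
qed

text \<open>Bar is an involution only after cancellation in the group. As it is multiplicative,
  checking single letters is enough.\<close>

lemma W_class_bar_bar:
  assumes "w \<in> words {1..<n}"
  shows "W_class n (bar_word (bar_word w)) = W_class n w"
  using assms
proof (induction w)
  case Nil
  then show ?case by simp
next
  case (Cons x w)
  obtain i b where x: "x = (i, b)" by force
  have i: "i \<in> {1..<n}" and w: "w \<in> words {1..<n}" using Cons.prems x by auto
  have letter: "W_class n (bar_word (bar_word [(i, b)])) = W_class n [(i, b)]"
  proof (cases "i = 2")
    case False
    then show ?thesis by (auto simp: bar_word_def)
  next
    case True
    \<comment> \<open>Applying bar twice gives sigma_1^-2 sigma_1^2 sigma_2 for sigma_2 and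
      sigma_2^-1 sigma_1^-2 sigma_1^2 for its inverse; two cancellations reduce each of
      them.\<close>
    have cancel: "W_class n (u @ (1, c) # (1, \<not> c) # v) = W_class n (u @ v)"
      if "u \<in> words {1..<n}" "v \<in> words {1..<n}" for u v c
      using that i True pres_cancel[of u "{1..<n}" v 1 c "W_relators n"]
      by (subst class_eq_iff[OF W_relators_in_words]) auto
    show ?thesis
      using i True cancel[of "[]" "[(2, True)]" False] cancel[of "[(2, False)]" "[]" False]
        cancel[of "[(1, False)]" "[(1, True), (2, True)]" False]
        cancel[of "[(2, False), (1, False)]" "[(1, True)]" False]
      by (cases b) (simp_all add: bar_word_def)
  qed
  have "W_class n (bar_word (bar_word (x # w)))
      = W_class n (bar_word (bar_word [(i, b)]) @ bar_word (bar_word w))"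
    using bar_word_simps(2)[of "[x]" w] by (simp add: x)
  also have "\<dots> = W_class n (bar_word (bar_word [(i, b)])) \<otimes>\<^bsub>W n\<^esub> W_class n (bar_word (bar_word w))"
    using i w by (intro W_class_mult[symmetric] bar_word_in_words) auto
  also have "\<dots> = W_class n (x # w)"
    unfolding letter Cons.IH[OF w] using i w by (simp add: W_class_mult x)
  finally show ?case .
qed

section \<open>Words acting on flags\<close>

text \<open>The monodromy action, with the rightmost letter applied first. The second branch inverts
  the first once the maps \<open>a j\<close> are involutions.\<close>

fun mon :: "(nat \<Rightarrow> 'x \<Rightarrow> 'x) \<Rightarrow> word \<Rightarrow> 'x \<Rightarrow> 'x" where
  "mon a [] x = x"
| "mon a ((i, b) # w) x =
     (if b then a (i - 1) (a i (mon a w x)) else a i (a (i - 1) (mon a w x)))"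

lemma mon_append: "mon a (u @ v) x = mon a u (mon a v x)"
  by (induction u) auto

text \<open>The letter sigma_{n-i}^-1 acts as a_{n-i} a_{n-i-1}, which is b_{i-1} b_i for the
  reversed indexing.\<close>

lemma mon_delta_word:
  assumes "w \<in> words {1..<n}" and "\<And>j. j < n \<Longrightarrow> b j = a (n - 1 - j)"
  shows "mon a (delta_word n w) x = mon b w x"
  using assms(1) by (induction w) (auto simp: delta_word_def assms(2) add.commute)

text \<open>The laws of the adjacency maps on flags, restricted to a set \<open>X\<close> because
  \<open>flag_adj\<close> is meaningful only there. They hold for a polytope and for its dual
  alike.\<close>

locale adjacency =
  fixes X :: "'x set" and n :: nat and a :: "nat \<Rightarrow> 'x \<Rightarrow> 'x"
  assumes adj_closed: "x \<in> X \<Longrightarrow> j < n \<Longrightarrow> a j x \<in> X"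
    and adj_adj: "x \<in> X \<Longrightarrow> j < n \<Longrightarrow> a j (a j x) = x"
    and adj_commute: "x \<in> X \<Longrightarrow> i + 1 < j \<Longrightarrow> j < n \<Longrightarrow> a i (a j x) = a j (a i x)"
begin

lemma mon_closed: "w \<in> words {1..<n} \<Longrightarrow> x \<in> X \<Longrightarrow> mon a w x \<in> X"
  by (induction w) (auto intro!: adj_closed)

text \<open>The product (a_{i-1} a_i)(a_i a_{i+1}) ... (a_{j-1} a_j) telescopes.\<close>

lemma mon_run:
  assumes "1 \<le> i" and "i \<le> j" and "j < n" and "x \<in> X"
  shows "mon a (run i j) x = a (i - 1) (a j x)"
  using assms
proof (induction "j - i" arbitrary: i)
  case 0
  then show ?case by (simp add: run_def)
next
  case (Suc k)
  then show ?case using Suc(1)[of "Suc i"] by (simp add: run_rec adj_adj adj_closed)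
qed

text \<open>For \<open>i < j\<close> the indices i - 1 and j differ by at least two, so a_{i-1} a_j
  is a product of commuting involutions and its square is trivial.\<close>

lemma mon_relator:
  assumes "r \<in> W_relators n" and "x \<in> X"
  shows "mon a r x = x"
proof -
  from assms obtain i j where ij: "1 \<le> i" "i < j" "j < n" and r: "r = run i j @ run i j"
    by (auto simp: W_relators_run)
  then show ?thesis
    using adj_commute[of x "i - 1" j] assms(2)
    by (simp add: mon_append mon_run adj_closed adj_adj)
qed

text \<open>Conjugation by a_0 turns a_0 a_1 into its inverse a_1 a_0, turns a_1 a_2 into (a_0
  a_1)^2 (a_1 a_2), and fixes a_{i-1} a_i for i at least 3. These are the substitutions defining
  bar.\<close>

lemma mon_bar_word:
  assumes "w \<in> words {1..<n}" and "0 < n" and "x \<in> X"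
  shows "mon a (bar_word w) x = a 0 (mon a w (a 0 x))"
  using assms(1)
proof (induction w)
  case Nil
  then show ?case using assms by (simp add: adj_adj)
next
  case (Cons l w)
  obtain i b where l: "l = (i, b)" by force
  define y where "y = mon a w (a 0 x)"
  have i: "1 \<le> i" "i < n" and w: "w \<in> words {1..<n}" using Cons.prems l by auto
  have y: "y \<in> X" using w assms by (simp add: y_def mon_closed adj_closed)
  have "bar_word (l # w) = bar_word [l] @ bar_word w"
    using bar_word_simps(2)[of "[l]" w] by simp
  then have "mon a (bar_word (l # w)) x = mon a (bar_word [l]) (a 0 y)"
    using Cons.IH[OF w] by (simp add: mon_append y_def)
  also have "\<dots> = a 0 (mon a [l] y)"
  proof -
    consider "i = 1" | "i = 2" | "3 \<le> i" using i by linarith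
    then show ?thesis
    proof cases
      case 3
      then show ?thesis
        using i y adj_commute[of y 0 i] adj_commute[of y 0 "i - 1"]
          adj_commute[of "a i y" 0 "i - 1"] adj_commute[of "a (i - 1) y" 0 i]
        by (auto simp: l bar_word_def adj_closed)
    next
      case 2
      then show ?thesis
        using i y adj_commute[of y 0 2] adj_commute[of "a 1 y" 0 2] adj_commute[of "a 0 y" 0 2]
        by (auto simp: l bar_word_def adj_closed adj_adj One_nat_def)
    qed (use i y in \<open>auto simp: l bar_word_def adj_closed adj_adj\<close>)
  qed
  finally show ?case by (simp add: l y_def)
qed

lemma mon_bar_bar_word:
  assumes "w \<in> words {1..<n}" and "0 < n" and "x \<in> X"
  shows "mon a (bar_word (bar_word w)) x = mon a w x"
  using assms by (simp add: mon_bar_word bar_word_in_words adj_closed adj_adj mon_closed)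

end

section \<open>Flags of a polytope\<close>

text \<open>Views a flag as a family of faces indexed by the ranks -1 to n, so that flags can be
  compared rank by rank.\<close>

definition flag_face :: "'a based_poset \<Rightarrow> 'a set \<Rightarrow> int \<Rightarrow> 'a" where
  "flag_face P \<Psi> r = (THE F. F \<in> \<Psi> \<and> rk P F = r)"

locale is_polytope =
  fixes n :: nat and P :: "'a based_poset"
  assumes polytope: "polytope n P"
begin

section \<open>Chains, flags and ranks\<close>

lemma partial_order: "Partial_order (face_le P)"
  and rk_bounds: "F \<in> faces P \<Longrightarrow> rk P F \<in> {-1..int n}"
  and rk_strict_mono: "face_less P F G \<Longrightarrow> rk P F < rk P G"
  and card_flag: "\<Psi> \<in> flags P \<Longrightarrow> card \<Psi> = n + 2"
  and diamond: "face_less P F G \<Longrightarrow> rk P G = rk P F + 2 \<Longrightarrow>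
        card {H. rk P H = rk P F + 1 \<and> face_less P F H \<and> face_less P H G} = 2"
  and flag_connected: "strongly_flag_connected P"
  and base_flag: "base P \<in> flags P"
  using polytope by (auto simp: polytope_def)

lemma face_le_refl: "F \<in> faces P \<Longrightarrow> (F, F) \<in> face_le P"
  and face_le_trans: "(F, G) \<in> face_le P \<Longrightarrow> (G, H) \<in> face_le P \<Longrightarrow> (F, H) \<in> face_le P"
  and face_le_faces: "(F, G) \<in> face_le P \<Longrightarrow> F \<in> faces P \<and> G \<in> faces P"
  using partial_order
  by (auto simp: partial_order_on_def preorder_on_def refl_on_def faces_def Field_def
      dest: transD)

lemma chain_faces: "C \<in> Chains (face_le P) \<Longrightarrow> C \<subseteq> faces P"
  using face_le_faces by (auto simp: Chains_def)

lemma chain_less: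
  assumes "C \<in> Chains (face_le P)" and "F \<in> C" and "G \<in> C" and "rk P F < rk P G"
  shows "face_less P F G"
  using assms rk_strict_mono[of G F] by (fastforce simp: Chains_def face_less_def)

lemma inj_on_rk_chain: "C \<in> Chains (face_le P) \<Longrightarrow> inj_on (rk P) C"
  using rk_strict_mono by (fastforce simp: Chains_def inj_on_def face_less_def)

lemma finite_chain: 
  assumes "C \<in> Chains (face_le P)"
  shows "finite C" and "card C \<le> n + 2"
proof -
  have sub: "rk P ` C \<subseteq> {-1..int n}" using chain_faces[OF assms] rk_bounds by blast
  then show "finite C"
    using inj_on_rk_chain[OF assms] by (metis finite_atLeastAtMost_int finite_imageD finite_subset)
  show "card C \<le> n + 2"
    using card_mono[OF _ sub] card_image[OF inj_on_rk_chain[OF assms]] by simp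
qed

lemma flag_chain: "\<Psi> \<in> flags P \<Longrightarrow> \<Psi> \<in> Chains (face_le P)"
  by (simp add: flags_def)

lemma flag_faces: "\<Psi> \<in> flags P \<Longrightarrow> \<Psi> \<subseteq> faces P"
  using flag_chain chain_faces by blast

text \<open>No chain has more than n + 2 faces, so a chain of that size is maximal.\<close>

lemma flagI:
  assumes "C \<in> Chains (face_le P)" and "card C = n + 2"
  shows "C \<in> flags P"
proof -
  have "C = D" if "D \<in> Chains (face_le P)" "C \<subseteq> D" for D
    using finite_chain[OF that(1)] assms(2) that(2) by (intro card_seteq) auto
  then show ?thesis using assms(1) by (simp add: flags_def)
qed

lemma chain_extends_to_flag:
  assumes "C \<in> Chains (face_le P)"
  shows "\<exists>\<Psi> \<in> flags P. C \<subseteq> \<Psi>"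
proof -
  let ?S = "{D \<in> Chains (face_le P). C \<subseteq> D}"
  \<comment> \<open>Sizes of chains are bounded, so a largest chain containing \<open>C\<close>
    exists; it is maximal.\<close>
  have "\<exists>D. D \<in> ?S \<and> (\<forall>E. E \<in> ?S \<longrightarrow> card E \<le> card D)"
    using assms finite_chain(2)
    by (intro ex_has_greatest_nat[of _ C _ "n + 3"]) (auto simp: less_Suc_eq_le numeral_3_eq_3)
  then obtain D where D: "D \<in> ?S" and max: "\<And>E. E \<in> ?S \<Longrightarrow> card E \<le> card D" by blast
  have "D = E" if "E \<in> Chains (face_le P)" "D \<subseteq> E" for E
    using that max[of E] D finite_chain(1)[of E] by (intro card_seteq) auto
  with D show ?thesis by (auto simp: flags_def)
qed

text \<open>The rank is injective on a chain, and a flag has as many faces as there are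
  ranks.\<close>

lemma rk_image_flag:
  assumes "\<Psi> \<in> flags P"
  shows "rk P ` \<Psi> = {-1..int n}"
proof (rule card_subset_eq)
  show "rk P ` \<Psi> \<subseteq> {-1..int n}" using flag_faces[OF assms] rk_bounds by blast
  show "card (rk P ` \<Psi>) = card {-1..int n}"
    using card_image[OF inj_on_rk_chain[OF flag_chain[OF assms]]] card_flag[OF assms] by simp
qed simp

lemma flag_face:
  assumes "\<Psi> \<in> flags P" and "r \<in> {-1..int n}"
  shows "flag_face P \<Psi> r \<in> \<Psi>" and "rk P (flag_face P \<Psi> r) = r"
proof -
  have "\<exists>!F. F \<in> \<Psi> \<and> rk P F = r"
    using rk_image_flag[OF assms(1)] inj_on_rk_chain[OF flag_chain[OF assms(1)]] assms(2)
    by (auto simp: inj_on_def image_iff set_eq_iff) metis+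
  from theI'[OF this] show "flag_face P \<Psi> r \<in> \<Psi>" "rk P (flag_face P \<Psi> r) = r"
    by (auto simp: flag_face_def)
qed

lemma flag_face_rk:
  assumes "\<Psi> \<in> flags P" and "F \<in> \<Psi>"
  shows "flag_face P \<Psi> (rk P F) = F"
proof -
  have "rk P F \<in> {-1..int n}" using flag_faces assms rk_bounds by blast
  then show ?thesis
    using flag_face[OF assms(1)] inj_on_rk_chain[OF flag_chain[OF assms(1)]] assms(2)
    by (metis inj_onD)
qed

lemma flag_face_less:
  assumes "\<Psi> \<in> flags P" and "-1 \<le> r" and "r < s" and "s \<le> int n"
  shows "face_less P (flag_face P \<Psi> r) (flag_face P \<Psi> s)"
  using assms flag_face[OF assms(1)] by (intro chain_less[OF flag_chain[OF assms(1)]]) auto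

section \<open>Comparing flags rank by rank, and adjacent flags\<close>

lemma flag_eqI:
  assumes A: "A \<in> flags P" and B: "B \<in> flags P"
    and eq: "\<And>r. r \<in> {-1..int n} \<Longrightarrow> flag_face P A r = flag_face P B r"
  shows "A = B"
proof -
  have "C = flag_face P C ` {-1..int n}" if "C \<in> flags P" for C
    using flag_face(1)[OF that] flag_face_rk[OF that] rk_image_flag[OF that] by force
  with A B eq show ?thesis by (metis image_cong)
qed

text \<open>Translates the set condition in the definition of \<open>flag_adj\<close> into a
  statement about single faces.\<close>

lemma off_rank_eq_iff:
  assumes A: "A \<in> flags P" and B: "B \<in> flags P"
  shows "{F \<in> A. rk P F \<noteq> s} = {F \<in> B. rk P F \<noteq> s} \<longleftrightarrow>
    (\<forall>r \<in> {-1..int n} - {s}. flag_face P A r = flag_face P B r)" (is "?L \<longleftrightarrow> ?R")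
proof
  assume L: ?L
  show ?R
  proof
    fix r assume r: "r \<in> {-1..int n} - {s}"
    then have "flag_face P A r \<in> {F \<in> A. rk P F \<noteq> s}" using flag_face[OF A] by auto
    then have "flag_face P A r \<in> B" using L by blast
    then show "flag_face P A r = flag_face P B r"
      using flag_face_rk[OF B] flag_face(2)[OF A, of r] r by fastforce
  qed
next
  assume R: ?R
  have *: "F \<in> D" if "C \<in> flags P" "D \<in> flags P" "F \<in> C" "rk P F \<noteq> s"
    "\<forall>r \<in> {-1..int n} - {s}. flag_face P C r = flag_face P D r" for C D F
  proof -
    have "rk P F \<in> {-1..int n} - {s}" using that flag_faces rk_bounds by blast
    then show ?thesis
      using that flag_face_rk[of C F] flag_face(1)[of D "rk P F"] by auto
  qed
  have R': "\<forall>r \<in> {-1..int n} - {s}. flag_face P B r = flag_face P A r" using R by simp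
  show ?L using *[OF A B _ _ R] *[OF B A _ _ R'] by blast
qed

text \<open>The diamond condition in terms of flags.\<close>

lemma flag_face_alternative_unique:
  assumes "A \<in> flags P" and "B \<in> flags P" and "C \<in> flags P" and j: "j < n"
    and low: "flag_face P A (int j - 1) = flag_face P C (int j - 1)"
             "flag_face P B (int j - 1) = flag_face P C (int j - 1)"
    and high: "flag_face P A (int j + 1) = flag_face P C (int j + 1)"
              "flag_face P B (int j + 1) = flag_face P C (int j + 1)"
    and neq: "flag_face P A (int j) \<noteq> flag_face P C (int j)"
             "flag_face P B (int j) \<noteq> flag_face P C (int j)"
  shows "flag_face P A (int j) = flag_face P B (int j)"
proof -
  let ?F = "flag_face P C (int j - 1)" and ?G = "flag_face P C (int j + 1)"
  let ?S = "{H. rk P H = rk P ?F + 1 \<and> face_less P ?F H \<and> face_less P H ?G}"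
  have "card ?S = 2"
    using assms(3) j by (intro diamond) (auto simp: flag_face flag_face_less)
  then obtain x y where S: "?S = {x, y}" by (auto simp: card_2_iff)
  have mem: "flag_face P D (int j) \<in> ?S"
    if "D \<in> flags P" "flag_face P D (int j - 1) = ?F" "flag_face P D (int j + 1) = ?G" for D
    using that j flag_face(2)[OF that(1)] flag_face(2)[OF assms(3)]
      flag_face_less[OF that(1), of "int j - 1" "int j"] flag_face_less[OF that(1), of "int j" "int j + 1"]
    by auto
  \<comment> \<open>All three faces lie in a two-element set, and two of them differ from the
    third.\<close>
  have "flag_face P A (int j) \<in> {x, y}" "flag_face P B (int j) \<in> {x, y}" "flag_face P C (int j) \<in> {x, y}"
    using assms mem[of A] mem[of B] mem[of C] unfolding S by blast+
  then show ?thesis using neq by auto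
qed

text \<open>The face of rank j is exchanged for the other middle face of the diamond around
  it.\<close>

lemma ex_adjacent_flag:
  assumes \<Psi>: "\<Psi> \<in> flags P" and j: "j < n"
  shows "\<exists>\<Psi>' \<in> flags P. \<Psi>' \<noteq> \<Psi> \<and>
    {F \<in> \<Psi>'. rk P F \<noteq> int j} = {F \<in> \<Psi>. rk P F \<noteq> int j}"
proof -
  let ?F = "flag_face P \<Psi> (int j - 1)" and ?G = "flag_face P \<Psi> (int j + 1)"
    and ?H = "flag_face P \<Psi> (int j)"
  let ?S = "{H. rk P H = rk P ?F + 1 \<and> face_less P ?F H \<and> face_less P H ?G}"
  have F: "?F \<in> \<Psi>" "rk P ?F = int j - 1" and G: "?G \<in> \<Psi>" "rk P ?G = int j + 1"
    and H: "?H \<in> \<Psi>" "rk P ?H = int j"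
    using flag_face[OF \<Psi>] j by auto
  have "card ?S = 2"
    using \<Psi> j F G by (intro diamond) (auto simp: flag_face_less)
  then obtain K where K: "K \<in> ?S" "K \<noteq> ?H" by (auto simp: card_2_iff)
  then have rkK: "rk P K = int j" and FK: "(?F, K) \<in> face_le P" and KG: "(K, ?G) \<in> face_le P"
    using F by (auto simp: face_less_def)
  have K\<Psi>: "K \<notin> \<Psi>" using flag_face_rk[OF \<Psi>, of K] K rkK by auto
  let ?X = "insert K (\<Psi> - {?H})"
  \<comment> \<open>Faces of the flag below rank j are compared with \<open>K\<close> through
    \<open>?F\<close>, those above through \<open>?G\<close>.\<close>
  have comp: "(L, K) \<in> face_le P \<or> (K, L) \<in> face_le P" if "L \<in> \<Psi> - {?H}" for L
  proof -
    have L: "L \<in> \<Psi>" "L \<noteq> ?H" using that by auto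
    have "rk P L \<noteq> int j" using flag_face_rk[OF \<Psi> L(1)] L(2) by auto
    then consider "rk P L < int j - 1" | "rk P L = int j - 1" | "rk P L = int j + 1" | "rk P L > int j + 1"
      by linarith
    then show ?thesis
    proof cases
      case 1
      then have "face_less P L ?F" using chain_less[OF flag_chain[OF \<Psi>] L(1) F(1)] F by simp
      then show ?thesis using FK face_le_trans by (auto simp: face_less_def)
    next
      case 2
      then show ?thesis using FK flag_face_rk[OF \<Psi> L(1)] by simp
    next
      case 3
      then show ?thesis using KG flag_face_rk[OF \<Psi> L(1)] by simp
    next
      case 4
      then have "face_less P ?G L" using chain_less[OF flag_chain[OF \<Psi>] G(1) L(1)] G by simp
      then show ?thesis using KG face_le_trans by (auto simp: face_less_def)
    qed
  qed
  have "(K, K) \<in> face_le P" using FK face_le_faces face_le_refl by blast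
  then have "?X \<in> Chains (face_le P)"
    using comp flag_chain[OF \<Psi>] by (auto simp: Chains_def)
  moreover have "card ?X = n + 2"
    using card_flag[OF \<Psi>] K\<Psi> H(1) finite_chain(1)[OF flag_chain[OF \<Psi>]] by simp
  ultimately have "?X \<in> flags P" by (rule flagI)
  moreover have "?X \<noteq> \<Psi>" using K\<Psi> by blast
  moreover have "{F \<in> ?X. rk P F \<noteq> int j} = {F \<in> \<Psi>. rk P F \<noteq> int j}"
    using rkK H(2) by auto
  ultimately show ?thesis by (intro bexI[of _ ?X] conjI)
qed

lemma flag_off_rank_neq:
  assumes "A \<in> flags P" and "B \<in> flags P" and "A \<noteq> B"
    and "\<forall>r \<in> {-1..int n} - {s}. flag_face P A r = flag_face P B r"
  shows "flag_face P A s \<noteq> flag_face P B s"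
  using assms flag_eqI[OF assms(1,2)] by blast

text \<open>By the diamond condition only one alternative face of rank j exists, so the description
  in \<open>flag_adj\<close> has a single solution.\<close>

lemma flag_adj_unique:
  assumes \<Psi>: "\<Psi> \<in> flags P" and j: "j < n" and "A \<in> flags P" and "A \<noteq> \<Psi>"
    and "\<forall>r \<in> {-1..int n} - {int j}. flag_face P A r = flag_face P \<Psi> r"
  shows "flag_adj P j \<Psi> = A"
  unfolding flag_adj_def
proof (rule the_equality)
  show "A \<in> flags P \<and> A \<noteq> \<Psi> \<and> {F \<in> A. rk P F \<noteq> int j} = {F \<in> \<Psi>. rk P F \<noteq> int j}"
    using assms off_rank_eq_iff by simp
next
  fix B assume "B \<in> flags P \<and> B \<noteq> \<Psi> \<and> {F \<in> B. rk P F \<noteq> int j} = {F \<in> \<Psi>. rk P F \<noteq> int j}"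
  then have B: "B \<in> flags P" "B \<noteq> \<Psi>" "\<forall>r \<in> {-1..int n} - {int j}. flag_face P B r = flag_face P \<Psi> r"
    using off_rank_eq_iff[of B \<Psi>] \<Psi> by auto
  show "B = A"
  proof (rule flag_eqI)
    fix r assume r: "r \<in> {-1..int n}"
    have "flag_face P B (int j) = flag_face P A (int j)"
      using assms B j
      by (intro flag_face_alternative_unique[of B A \<Psi> j] flag_off_rank_neq) auto
    then show "flag_face P B r = flag_face P A r" using r assms(5) B(3) by (cases "r = int j") auto
  qed (use assms B in auto)
qed

lemma
  assumes \<Psi>: "\<Psi> \<in> flags P" and j: "j < n"
  shows flag_adj_flag: "flag_adj P j \<Psi> \<in> flags P"
    and flag_face_flag_adj:
      "r \<in> {-1..int n} \<Longrightarrow> r \<noteq> int j \<Longrightarrow> flag_face P (flag_adj P j \<Psi>) r = flag_face P \<Psi> r"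
    and flag_face_flag_adj_neq: "flag_face P (flag_adj P j \<Psi>) (int j) \<noteq> flag_face P \<Psi> (int j)"
proof -
  obtain A where A: "A \<in> flags P" "A \<noteq> \<Psi>"
      "{F \<in> A. rk P F \<noteq> int j} = {F \<in> \<Psi>. rk P F \<noteq> int j}"
    using ex_adjacent_flag[OF assms] by blast
  then have off: "\<forall>r \<in> {-1..int n} - {int j}. flag_face P A r = flag_face P \<Psi> r"
    using off_rank_eq_iff \<Psi> by blast
  then have eq: "flag_adj P j \<Psi> = A" using A \<Psi> j by (intro flag_adj_unique)
  show "flag_adj P j \<Psi> \<in> flags P" using A eq by simp
  show "r \<in> {-1..int n} \<Longrightarrow> r \<noteq> int j \<Longrightarrow> flag_face P (flag_adj P j \<Psi>) r = flag_face P \<Psi> r"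
    using eq off by simp
  show "flag_face P (flag_adj P j \<Psi>) (int j) \<noteq> flag_face P \<Psi> (int j)"
    using eq flag_off_rank_neq[OF A(1) \<Psi> A(2) off] by simp
qed

lemma flag_adj_flag_adj:
  assumes \<Psi>: "\<Psi> \<in> flags P" and j: "j < n"
  shows "flag_adj P j (flag_adj P j \<Psi>) = \<Psi>"
  using assms flag_face_flag_adj[OF assms] flag_face_flag_adj_neq[OF assms]
  by (intro flag_adj_unique flag_adj_flag) auto

text \<open>Both sides agree with the original flag off the ranks i and j. Since these are not
  neighbours, the faces just below and above each of them are unchanged, so both sides carry the
  same alternative face there.\<close>

lemma flag_adj_commute:
  assumes \<Psi>: "\<Psi> \<in> flags P" and ij: "i + 1 < j" and j: "j < n"
  shows "flag_adj P i (flag_adj P j \<Psi>) = flag_adj P j (flag_adj P i \<Psi>)"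
proof (rule flag_eqI)
  let ?A = "flag_adj P i (flag_adj P j \<Psi>)" and ?B = "flag_adj P j (flag_adj P i \<Psi>)"
  have i: "i < n" using ij j by simp
  have fl: "flag_adj P i \<Psi> \<in> flags P" "flag_adj P j \<Psi> \<in> flags P"
    using \<Psi> i j by (auto intro: flag_adj_flag)
  show A: "?A \<in> flags P" and B: "?B \<in> flags P" using fl i j by (auto intro: flag_adj_flag)
  note f = flag_face_flag_adj[OF \<Psi> i] flag_face_flag_adj[OF \<Psi> j]
    flag_face_flag_adj[OF fl(1) j] flag_face_flag_adj[OF fl(2) i]
  note g = flag_face_flag_adj_neq[OF \<Psi> i] flag_face_flag_adj_neq[OF \<Psi> j]
    flag_face_flag_adj_neq[OF fl(1) j] flag_face_flag_adj_neq[OF fl(2) i]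
  fix r assume r: "r \<in> {-1..int n}"
  have "flag_face P ?A (int i) = flag_face P ?B (int i)"
    using f g i j ij by (intro flag_face_alternative_unique[OF A B \<Psi> i]) auto
  moreover have "flag_face P ?A (int j) = flag_face P ?B (int j)"
    using f g i j ij by (intro flag_face_alternative_unique[OF A B \<Psi> j]) auto
  ultimately show "flag_face P ?A r = flag_face P ?B r"
    using f r by (cases "r = int i \<or> r = int j") auto
qed

sublocale adjacency "flags P" n "flag_adj P"
  by unfold_locales (rule flag_adj_flag flag_adj_flag_adj flag_adj_commute; assumption)+

section \<open>Adjacency as a set relation, and induction over flags\<close>

text \<open>A face comparable with all others lies in every maximal chain; this applies to the least
  and the greatest face.\<close>

lemma flag_extreme_faces:
  obtains L U where "\<And>\<Psi>. \<Psi> \<in> flags P \<Longrightarrow> flag_face P \<Psi> (-1) = L"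
    and "\<And>\<Psi>. \<Psi> \<in> flags P \<Longrightarrow> flag_face P \<Psi> (int n) = U"
proof -
  have *: "flag_face P \<Psi> (rk P L) = L"
    if "L \<in> faces P" "\<forall>G \<in> faces P. (L, G) \<in> face_le P \<or> (G, L) \<in> face_le P" "\<Psi> \<in> flags P" for L \<Psi>
  proof -
    have "insert L \<Psi> \<in> Chains (face_le P)"
      using that flag_chain[OF that(3)] flag_faces[OF that(3)] face_le_refl by (auto simp: Chains_def)
    then have "L \<in> \<Psi>" using that(3) by (auto simp: flags_def)
    then show ?thesis using flag_face_rk that(3) by simp
  qed
  obtain L where "L \<in> faces P" "rk P L = -1" "\<forall>G \<in> faces P. (L, G) \<in> face_le P"
    using polytope unfolding polytope_def by blast
  moreover obtain U where "U \<in> faces P" "rk P U = int n" "\<forall>G \<in> faces P. (G, U) \<in> face_le P"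
    using polytope unfolding polytope_def by blast
  ultimately show ?thesis using *[of L] *[of U] by (intro that[of L U]) auto
qed

lemma adjacent_flag_adj:
  assumes A: "A \<in> flags P" and B: "B \<in> flags P" and adj: "adjacent A B"
  shows "\<exists>j < n. B = flag_adj P j A"
proof -
  obtain F G where F: "A - B = {F}" and G: "B - A = {G}"
    using adj unfolding adjacent_def by (metis card_1_singletonE)
  have common: "flag_face P A r = flag_face P B r" if "r \<in> {-1..int n}" "r \<noteq> rk P F" for r
  proof -
    have "flag_face P A r \<in> A" "flag_face P A r \<noteq> F" using flag_face[OF A that(1)] that(2) by auto
    then have "flag_face P A r \<in> B" using F by blast
    then show ?thesis using flag_face_rk[OF B] flag_face(2)[OF A that(1)] by metis
  qed
  have FA: "F \<in> A" and "F \<notin> B" using F by auto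
  have r: "rk P F \<in> {-1..int n}" using FA flag_faces[OF A] rk_bounds by blast
  have neq: "flag_face P A (rk P F) \<noteq> flag_face P B (rk P F)"
    using flag_face_rk[OF A FA] flag_face(1)[OF B r] \<open>F \<notin> B\<close> by auto
  \<comment> \<open>The extreme faces are shared by all flags, so the flags differ at a rank between
    0 and n - 1.\<close>
  have "rk P F \<noteq> -1" "rk P F \<noteq> int n"
    using neq A B flag_extreme_faces by metis+
  then obtain j where j: "rk P F = int j" "j < n"
    using r nonneg_int_cases[of "rk P F"] by force
  have "flag_adj P j A = B"
    using A B j common neq by (intro flag_adj_unique) auto
  then show ?thesis using j by blast
qed

lemma adjacent_flag_adjI:
  assumes A: "A \<in> flags P" and j: "j < n"
  shows "adjacent A (flag_adj P j A)"
proof -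
  have *: "C - D = {flag_face P C (int j)}"
    if C: "C \<in> flags P" and D: "D \<in> flags P"
      and eq: "\<And>r. r \<in> {-1..int n} \<Longrightarrow> r \<noteq> int j \<Longrightarrow> flag_face P C r = flag_face P D r"
      and neq: "flag_face P C (int j) \<noteq> flag_face P D (int j)" for C D
  proof -
    have rj: "int j \<in> {-1..int n}" using j by simp
    have "flag_face P C (int j) \<notin> D"
      using flag_face_rk[OF D, of "flag_face P C (int j)"] flag_face(2)[OF C rj] neq by auto
    moreover have "F = flag_face P C (int j)" if "F \<in> C" "F \<notin> D" for F
    proof (rule ccontr)
      assume "F \<noteq> flag_face P C (int j)"
      then have "rk P F \<noteq> int j" "rk P F \<in> {-1..int n}"
        using flag_face_rk[OF C that(1)] that flag_faces[OF C] rk_bounds by auto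
      then have "F \<in> D" using eq[of "rk P F"] flag_face_rk[OF C that(1)] flag_face(1)[OF D] by metis
      then show False using that by simp
    qed
    ultimately show ?thesis using flag_face(1)[OF C rj] by blast
  qed
  note B = flag_adj_flag[OF A j]
  have "A - flag_adj P j A = {flag_face P A (int j)}"
    using flag_face_flag_adj[OF A j] flag_face_flag_adj_neq[OF A j] by (intro *[OF A B]) auto
  moreover have "flag_adj P j A - A = {flag_face P (flag_adj P j A) (int j)}"
    using flag_face_flag_adj[OF A j] flag_face_flag_adj_neq[OF A j] by (intro *[OF B A]) auto
  ultimately show ?thesis by (simp add: adjacent_def)
qed

text \<open>Consecutive flags of a connecting sequence are related by some
  \<open>flag_adj P j\<close>, so the property spreads along it.\<close>

lemma flag_induct:
  assumes A: "A \<in> flags P" and B: "B \<in> flags P" and "Q A"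
    and step: "\<And>C j. C \<in> flags P \<Longrightarrow> j < n \<Longrightarrow> Q C \<Longrightarrow> Q (flag_adj P j C)"
  shows "Q B"
proof -
  have "(A, B) \<in> {(C, D). C \<in> flags P \<and> D \<in> flags P \<and> adjacent C D \<and> A \<inter> B \<subseteq> C \<and> A \<inter> B \<subseteq> D}\<^sup>*"
    using flag_connected A B by (simp add: strongly_flag_connected_def)
  then show ?thesis
    by (induction rule: rtrancl_induct) (use \<open>Q A\<close> step adjacent_flag_adj in blast)+
qed

end

section \<open>Automorphisms and rotations\<close>

lemma aut_group_simps:
  "carrier (aut_group P) = {f \<in> Bij (faces P). \<forall>F \<in> faces P. \<forall>G \<in> faces P.
      (F, G) \<in> face_le P \<longleftrightarrow> (f F, f G) \<in> face_le P}"
  "f \<otimes>\<^bsub>aut_group P\<^esub> g = compose (faces P) g f"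
  "\<one>\<^bsub>aut_group P\<^esub> = (\<lambda>F \<in> faces P. F)"
  by (simp_all add: aut_group_def)

lemma group_aut_group: "group (aut_group P)"
proof (rule groupI)
  fix f g assume fg: "f \<in> carrier (aut_group P)" "g \<in> carrier (aut_group P)"
  have "f F \<in> faces P" if "F \<in> faces P" for F
    using that fg(1) by (auto simp: aut_group_simps Bij_def bij_betw_def)
  then have "(F, G) \<in> face_le P \<longleftrightarrow> (g (f F), g (f G)) \<in> face_le P"
    if "F \<in> faces P" "G \<in> faces P" for F G
    using fg that unfolding aut_group_simps by blast
  moreover have "compose (faces P) g f \<in> Bij (faces P)"
    using fg by (intro compose_Bij) (auto simp: aut_group_simps)
  ultimately show "f \<otimes>\<^bsub>aut_group P\<^esub> g \<in> carrier (aut_group P)"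
    by (simp add: aut_group_simps compose_eq)
next
  show "\<one>\<^bsub>aut_group P\<^esub> \<in> carrier (aut_group P)"
    by (auto simp: aut_group_simps id_Bij)
next
  fix f g h
  assume "f \<in> carrier (aut_group P)" "g \<in> carrier (aut_group P)" "h \<in> carrier (aut_group P)"
  then show "f \<otimes>\<^bsub>aut_group P\<^esub> g \<otimes>\<^bsub>aut_group P\<^esub> h = f \<otimes>\<^bsub>aut_group P\<^esub> (g \<otimes>\<^bsub>aut_group P\<^esub> h)"
    by (auto simp: aut_group_simps compose_def Bij_def bij_betw_def fun_eq_iff restrict_def)
next
  fix f assume "f \<in> carrier (aut_group P)"
  then show "\<one>\<^bsub>aut_group P\<^esub> \<otimes>\<^bsub>aut_group P\<^esub> f = f"
    by (auto simp: aut_group_simps compose_def Bij_def extensional_def fun_eq_iff)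
next
  fix f assume f: "f \<in> carrier (aut_group P)"
  define g where "g = restrict (inv_into (faces P) f) (faces P)"
  have bij: "bij_betw f (faces P) (faces P)"
    using f by (auto simp: aut_group_simps Bij_def)
  have g: "g F \<in> faces P" "f (g F) = F" if "F \<in> faces P" for F
    using that bij by (auto simp: g_def bij_betw_def f_inv_into_f inv_into_into)
  have "g \<in> Bij (faces P)"
    using f unfolding g_def by (intro restrict_inv_into_Bij) (auto simp: aut_group_simps)
  moreover have "(F, G) \<in> face_le P \<longleftrightarrow> (g F, g G) \<in> face_le P" if "F \<in> faces P" "G \<in> faces P" for F G
  proof -
    have "(g F, g G) \<in> face_le P \<longleftrightarrow> (f (g F), f (g G)) \<in> face_le P"
      using f g(1) that unfolding aut_group_simps by blast
    then show ?thesis using g(2) that by simp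
  qed
  ultimately have "g \<in> carrier (aut_group P)" by (simp add: aut_group_simps)
  moreover have "g \<otimes>\<^bsub>aut_group P\<^esub> f = \<one>\<^bsub>aut_group P\<^esub>"
    using g by (auto simp: aut_group_simps compose_def fun_eq_iff restrict_def)
  ultimately show "\<exists>g \<in> carrier (aut_group P). g \<otimes>\<^bsub>aut_group P\<^esub> f = \<one>\<^bsub>aut_group P\<^esub>" by blast
qed

lemma aut_mult_image:
  "A \<subseteq> faces P \<Longrightarrow> (f \<otimes>\<^bsub>aut_group P\<^esub> g) ` A = g ` (f ` A)"
  by (auto simp: aut_group_simps compose_def)

lemma aut_one_image: "A \<subseteq> faces P \<Longrightarrow> \<one>\<^bsub>aut_group P\<^esub> ` A = A"
  by (auto simp: aut_group_simps)

section \<open>Automorphisms preserve ranks and act freely on flags\<close>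

context is_polytope
begin

lemma aut_less_iff:
  assumes "f \<in> carrier (aut_group P)" and "F \<in> faces P" and "G \<in> faces P"
  shows "face_less P (f F) (f G) \<longleftrightarrow> face_less P F G"
  using assms by (auto simp: aut_group_simps face_less_def Bij_def bij_betw_def inj_on_def)

lemma aut_inj_on: "f \<in> carrier (aut_group P) \<Longrightarrow> inj_on f (faces P)"
  by (auto simp: aut_group_simps Bij_def bij_betw_def)

lemma aut_flag:
  assumes f: "f \<in> carrier (aut_group P)" and \<Psi>: "\<Psi> \<in> flags P"
  shows "f ` \<Psi> \<in> flags P"
proof (rule flagI)
  show "f ` \<Psi> \<in> Chains (face_le P)"
    using f flag_chain[OF \<Psi>] flag_faces[OF \<Psi>] by (auto simp: Chains_def aut_group_simps subset_iff)
  show "card (f ` \<Psi>) = n + 2"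
    using card_image[OF inj_on_subset[OF aut_inj_on[OF f] flag_faces[OF \<Psi>]]] card_flag[OF \<Psi>] by simp
qed

text \<open>Recovers the rank of a face from the order alone.\<close>

lemma card_below_in_flag:
  assumes \<Psi>: "\<Psi> \<in> flags P" and F: "F \<in> \<Psi>"
  shows "int (card {G \<in> \<Psi>. face_less P G F}) = rk P F + 1"
proof -
  have r: "rk P F \<in> {-1..int n}" using F flag_faces[OF \<Psi>] rk_bounds by blast
  have "rk P ` {G \<in> \<Psi>. face_less P G F} = {-1..rk P F - 1}" (is "?L = ?R")
  proof
    show "?L \<subseteq> ?R"
    proof
      fix r assume "r \<in> ?L"
      then obtain G where "G \<in> \<Psi>" "face_less P G F" "r = rk P G" by blast
      then show "r \<in> ?R"
        using rk_strict_mono[of G F] rk_bounds[of G] flag_faces[OF \<Psi>] by auto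
    qed
    show "?R \<subseteq> ?L"
    proof
      fix r assume "r \<in> ?R"
      then have "r \<in> {-1..int n}" "-1 \<le> r" "r < rk P F" "rk P F \<le> int n"
        using \<open>rk P F \<in> {-1..int n}\<close> by auto
      then show "r \<in> ?L"
        using flag_face[OF \<Psi>, of r] flag_face_less[OF \<Psi>, of r "rk P F"] flag_face_rk[OF \<Psi> F]
        by (intro image_eqI[of _ _ "flag_face P \<Psi> r"]) auto
    qed
  qed
  moreover have "inj_on (rk P) {G \<in> \<Psi>. face_less P G F}"
    using inj_on_rk_chain[OF flag_chain[OF \<Psi>]] by (rule inj_on_subset) auto
  ultimately have "card {G \<in> \<Psi>. face_less P G F} = card {-1..rk P F - 1}"
    using card_image by metis
  then show ?thesis using r by simp
qed

text \<open>Automorphisms are only required to preserve the order. They preserve the number of faces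
  below a given one in a flag, and hence the rank.\<close>

lemma aut_rk:
  assumes f: "f \<in> carrier (aut_group P)" and F: "F \<in> faces P"
  shows "rk P (f F) = rk P F"
proof -
  have "{F} \<in> Chains (face_le P)" using face_le_refl[OF F] by (simp add: Chains_def)
  then obtain \<Psi> where \<Psi>: "\<Psi> \<in> flags P" "F \<in> \<Psi>" using chain_extends_to_flag by blast
  have sub: "{G \<in> \<Psi>. face_less P G F} \<subseteq> faces P" using flag_faces[OF \<Psi>(1)] by blast
  have "{G \<in> f ` \<Psi>. face_less P G (f F)} = f ` {G \<in> \<Psi>. face_less P G F}"
    using aut_less_iff[OF f _ F] flag_faces[OF \<Psi>(1)] by auto
  then have "card {G \<in> f ` \<Psi>. face_less P G (f F)} = card {G \<in> \<Psi>. face_less P G F}"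
    using card_image[OF inj_on_subset[OF aut_inj_on[OF f] sub]] by simp
  then show ?thesis
    using card_below_in_flag[OF \<Psi>] card_below_in_flag[OF aut_flag[OF f \<Psi>(1)], of "f F"] \<Psi>(2) by simp
qed

lemma flag_face_aut:
  assumes f: "f \<in> carrier (aut_group P)" and \<Psi>: "\<Psi> \<in> flags P" and r: "r \<in> {-1..int n}"
  shows "flag_face P (f ` \<Psi>) r = f (flag_face P \<Psi> r)"
proof -
  note F = flag_face[OF \<Psi> r]
  have "rk P (f (flag_face P \<Psi> r)) = r" using aut_rk[OF f] F flag_faces[OF \<Psi>] by auto
  then show ?thesis using flag_face_rk[OF aut_flag[OF f \<Psi>], of "f (flag_face P \<Psi> r)"] F by simp
qed

lemma aut_flag_adj:
  assumes f: "f \<in> carrier (aut_group P)" and \<Psi>: "\<Psi> \<in> flags P" and j: "j < n"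
  shows "f ` flag_adj P j \<Psi> = flag_adj P j (f ` \<Psi>)"
proof (rule sym, rule flag_adj_unique)
  note A = flag_adj_flag[OF \<Psi> j]
  show "\<forall>r \<in> {-1..int n} - {int j}. flag_face P (f ` flag_adj P j \<Psi>) r = flag_face P (f ` \<Psi>) r"
    using f A \<Psi> flag_face_flag_adj[OF \<Psi> j] by (auto simp: flag_face_aut)
  show "f ` flag_adj P j \<Psi> \<noteq> f ` \<Psi>"
    using inj_on_image_eq_iff[OF aut_inj_on[OF f] flag_faces[OF A] flag_faces[OF \<Psi>]]
      flag_face_flag_adj_neq[OF \<Psi> j] by auto
qed (use assms in \<open>auto intro: aut_flag flag_adj_flag\<close>)

text \<open>Freeness of the action: agreement on one flag spreads to all flags by adjacency, and
  every face lies in a flag.\<close>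

lemma aut_eqI:
  assumes f: "f \<in> carrier (aut_group P)" and g: "g \<in> carrier (aut_group P)"
    and \<Phi>: "\<Phi> \<in> flags P" and eq: "f ` \<Phi> = g ` \<Phi>"
  shows "f = g"
proof (rule extensionalityI)
  show "f \<in> extensional (faces P)" "g \<in> extensional (faces P)"
    using f g by (auto simp: aut_group_simps Bij_def)
  fix F assume F: "F \<in> faces P"
  then have "{F} \<in> Chains (face_le P)" using face_le_refl[OF F] by (simp add: Chains_def)
  then obtain \<Psi> where \<Psi>: "\<Psi> \<in> flags P" "F \<in> \<Psi>" using chain_extends_to_flag by blast
  have "f ` \<Psi> = g ` \<Psi>"
    by (rule flag_induct[OF \<Phi> \<Psi>(1)]) (simp_all add: eq aut_flag_adj[OF f] aut_flag_adj[OF g])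
  moreover have "rk P F \<in> {-1..int n}" using F rk_bounds by blast
  ultimately show "f F = g F"
    using flag_face_aut[OF f \<Psi>(1), of "rk P F"] flag_face_aut[OF g \<Psi>(1), of "rk P F"]
      flag_face_rk[OF \<Psi>] by simp
qed

text \<open>The monodromy action commutes with automorphisms, because each adjacency map
  does.\<close>

lemma aut_mon:
  assumes f: "f \<in> carrier (aut_group P)" and "w \<in> words {1..<n}" and \<Psi>: "\<Psi> \<in> flags P"
  shows "f ` mon (flag_adj P) w \<Psi> = mon (flag_adj P) w (f ` \<Psi>)"
  using assms(2)
proof (induction w)
  case (Cons x w)
  then show ?case
    using mon_closed[of w \<Psi>] \<Psi> by (cases x) (simp add: aut_flag_adj[OF f] flag_adj_flag less_imp_diff_less)
qed simp

lemma base_to: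
  assumes "f \<in> carrier (aut_group P)" and "f ` base P = \<Psi>"
  shows "base_to P \<Psi> = f"
  unfolding base_to_def using assms aut_eqI[OF _ _ base_flag] by (intro the_equality) auto

end

text \<open>Regular polytopes and chiral polytopes both satisfy this condition.\<close>

locale rotary_polytope = is_polytope +
  assumes ex_rotation: "i \<in> {1..<n} \<Longrightarrow> \<exists>f \<in> carrier (aut_group P).
    f ` base P = flag_adj P (i - 1) (flag_adj P i (base P))"
begin

text \<open>Merges the two branches in the definition of \<open>sigma\<close>. In the regular case
  the product is read from left to right: rho_{i-1} gives the flag adjacent at i - 1, and rho_i
  commutes with that adjacency.\<close>

lemma
  assumes i: "i \<in> {1..<n}"
  shows sigma_aut: "sigma P i \<in> carrier (aut_group P)"
    and sigma_base: "sigma P i ` base P = flag_adj P (i - 1) (flag_adj P i (base P))"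
proof -
  have "sigma P i \<in> carrier (aut_group P) \<and>
    sigma P i ` base P = flag_adj P (i - 1) (flag_adj P i (base P))"
  proof (cases "regular P")
    case False
    obtain f where "f \<in> carrier (aut_group P)"
      "f ` base P = flag_adj P (i - 1) (flag_adj P i (base P))" using ex_rotation[OF i] by blast
    then show ?thesis using base_to[of f] False by (simp add: sigma_def)
  next
    case True
    interpret A: group "aut_group P" by (rule group_aut_group)
    have rho: "rho P j \<in> carrier (aut_group P) \<and> rho P j ` base P = flag_adj P j (base P)"
      if j: "j < n" for j
    proof -
      obtain f where "f \<in> carrier (aut_group P)" "f ` base P = flag_adj P j (base P)"
        using True base_flag flag_adj_flag[OF base_flag j] unfolding regular_def by blast
      then show ?thesis using base_to[of f] by (simp add: rho_def)
    qed
    have ij: "i < n" "i - 1 < n" using i by auto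
    then have "(rho P (i - 1) \<otimes>\<^bsub>aut_group P\<^esub> rho P i) ` base P
        = flag_adj P (i - 1) (flag_adj P i (base P))"
      using rho[OF ij(1)] rho[OF ij(2)] aut_flag_adj[OF _ base_flag ij(2)]
      by (simp add: aut_mult_image[OF flag_faces[OF base_flag]])
    then show ?thesis using rho[OF ij(1)] rho[OF ij(2)] True by (simp add: sigma_def)
  qed
  then show "sigma P i \<in> carrier (aut_group P)"
    "sigma P i ` base P = flag_adj P (i - 1) (flag_adj P i (base P))" by auto
qed

text \<open>For a first letter sigma_i and a remaining word with value y, the product applies
  sigma_i and then y. As y commutes with adjacency, the result is a_{i-1} a_i applied to the image
  of the base flag under y, in accordance with \<open>mon\<close>.\<close>

lemma word_eval_sigma_base:
  assumes "w \<in> words {1..<n}"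
  shows "word_eval (aut_group P) (sigma P) w ` base P = mon (flag_adj P) w (base P)"
  using assms
proof (induction w)
  case Nil
  then show ?case by (simp add: aut_one_image[OF flag_faces[OF base_flag]])
next
  case (Cons x w)
  interpret A: group "aut_group P" by (rule group_aut_group)
  obtain i b where x: "x = (i, b)" by force
  have i: "i \<in> {1..<n}" and w: "w \<in> words {1..<n}" using Cons.prems x by auto
  have ij: "i < n" "i - 1 < n" using i by auto
  let ?s = "sigma P i" and ?y = "word_eval (aut_group P) (sigma P) w"
  let ?B = "flag_adj P i (flag_adj P (i - 1) (base P))"
  have s: "?s \<in> carrier (aut_group P)" by (rule sigma_aut[OF i])
  have y: "?y \<in> carrier (aut_group P)" using w sigma_aut by (rule A.word_eval_closed)
  have B: "?B \<in> flags P" using ij base_flag by (simp add: flag_adj_flag)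
  \<comment> \<open>Finding the flag that sigma_i sends to the base flag determines the image of the
    base flag under the inverse.\<close>
  have "?s ` ?B = base P"
    using s ij base_flag sigma_base[OF i]
    by (simp add: aut_flag_adj flag_adj_flag flag_adj_flag_adj)
  then have "(?s \<otimes>\<^bsub>aut_group P\<^esub> inv\<^bsub>aut_group P\<^esub> ?s) ` ?B = (inv\<^bsub>aut_group P\<^esub> ?s) ` base P"
    using aut_mult_image[OF flag_faces[OF B]] by simp
  then have inv: "(inv\<^bsub>aut_group P\<^esub> ?s) ` base P = ?B"
    using s by (simp add: aut_one_image[OF flag_faces[OF B]])
  show ?case
    using Cons.IH[OF w] ij y base_flag
    by (simp add: x aut_mult_image[OF flag_faces[OF base_flag]] inv sigma_base[OF i] aut_flag_adj flag_adj_flag)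
qed

text \<open>An automorphism fixing one flag is the identity, so the kernel becomes a stabilizer in
  the monodromy action.\<close>

lemma word_eval_sigma_eq_one_iff:
  assumes w: "w \<in> words {1..<n}"
  shows "word_eval (aut_group P) (sigma P) w = \<one>\<^bsub>aut_group P\<^esub> \<longleftrightarrow>
    mon (flag_adj P) w (base P) = base P"
proof -
  interpret A: group "aut_group P" by (rule group_aut_group)
  have "word_eval (aut_group P) (sigma P) w \<in> carrier (aut_group P)"
    using w sigma_aut by (rule A.word_eval_closed)
  then show ?thesis
    using aut_eqI[OF _ A.one_closed base_flag] word_eval_sigma_base[OF w]
      aut_one_image[OF flag_faces[OF base_flag]] by metis
qed

lemma sigma_rot_group: "i \<in> {1..<n} \<Longrightarrow> sigma P i \<in> carrier (rot_group n P)"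
  by (auto simp: rot_group_def sigma_aut intro: generate.incl)

lemma rot_group_subgroup:
  "subgroup (carrier (rot_group n P)) (aut_group P)"
  "rot_group n P = (aut_group P)\<lparr>carrier := carrier (rot_group n P)\<rparr>"
proof -
  interpret A: group "aut_group P" by (rule group_aut_group)
  show "subgroup (carrier (rot_group n P)) (aut_group P)"
    using sigma_aut by (auto simp: rot_group_def A.subgroup_self intro!: A.generate_is_subgroup)
qed (auto simp: rot_group_def)

lemma group_rot_group: "group (rot_group n P)"
  using rot_group_subgroup group_aut_group subgroup.subgroup_is_group by metis

lemma word_eval_rot_group:
  assumes "w \<in> words {1..<n}"
  shows "word_eval (rot_group n P) (sigma P) w = word_eval (aut_group P) (sigma P) w"
  using group.word_eval_subgroup[OF group_aut_group rot_group_subgroup(1) sigma_rot_group assms]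
    rot_group_subgroup(2) by simp

lemma one_rot_group: "\<one>\<^bsub>rot_group n P\<^esub> = \<one>\<^bsub>aut_group P\<^esub>"
  by (simp add: rot_group_def)

end

text \<open>A word evaluates in the mix to the pair of its values, so the kernel is the intersection
  of the two base flag stabilizers. The generators satisfy the relators of \<open>W n\<close>
  because these act trivially on flags.\<close>

lemma mix_eq:
  assumes P: "rotary_polytope n P" and Q: "rotary_polytope n Q"
  shows "mix n P Q = {W_class n w | w. w \<in> words {1..<n} \<and>
    mon (flag_adj P) w (base P) = base P \<and> mon (flag_adj Q) w (base Q) = base Q}"
proof -
  interpret P: rotary_polytope n P by fact
  interpret Q: rotary_polytope n Q by fact
  let ?D = "rot_group n P \<times>\<times> rot_group n Q"
  interpret D: group ?D
    by (intro DirProd_group P.group_rot_group Q.group_rot_group)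
  have gen: "mix_gen P Q i \<in> carrier ?D" if "i \<in> {1..<n}" for i
    using that by (simp add: mix_gen_def P.sigma_rot_group Q.sigma_rot_group)
  then have sub: "subgroup (generate ?D (mix_gen P Q ` {1..<n})) ?D"
    by (intro D.generate_is_subgroup) blast
  then have grp: "group (mix_group n P Q)"
    unfolding mix_group_def by (rule D.subgroup_imp_group)
  have gen': "mix_gen P Q i \<in> carrier (mix_group n P Q)" if "i \<in> {1..<n}" for i
    using that by (auto simp: mix_group_def intro: generate.incl)
  have ev: "word_eval (mix_group n P Q) (mix_gen P Q) w =
      (word_eval (aut_group P) (sigma P) w, word_eval (aut_group Q) (sigma Q) w)"
    if w: "w \<in> words {1..<n}" for w
  proof -
    have "word_eval (mix_group n P Q) (mix_gen P Q) w = word_eval ?D (mix_gen P Q) w"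
      unfolding mix_group_def using w
      by (intro D.word_eval_subgroup[OF sub]) (auto intro: generate.incl)
    also have "\<dots> = (word_eval (rot_group n P) (sigma P) w, word_eval (rot_group n Q) (sigma Q) w)"
      unfolding mix_gen_def[abs_def]
      by (rule word_eval_DirProd[OF P.group_rot_group Q.group_rot_group w])
        (auto intro: P.sigma_rot_group Q.sigma_rot_group)
    finally show ?thesis using w by (simp add: P.word_eval_rot_group Q.word_eval_rot_group)
  qed
  have one: "\<one>\<^bsub>mix_group n P Q\<^esub> = (\<one>\<^bsub>aut_group P\<^esub>, \<one>\<^bsub>aut_group Q\<^esub>)"
    by (simp add: mix_group_def P.one_rot_group Q.one_rot_group)
  have triv: "word_eval (mix_group n P Q) (mix_gen P Q) w = \<one>\<^bsub>mix_group n P Q\<^esub> \<longleftrightarrow>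
      mon (flag_adj P) w (base P) = base P \<and> mon (flag_adj Q) w (base Q) = base Q"
    if w: "w \<in> words {1..<n}" for w
    using w by (simp add: ev one P.word_eval_sigma_eq_one_iff Q.word_eval_sigma_eq_one_iff)
  have hom: "gen_hom (mix_group n P Q) (mix_gen P Q) (W_class n w) =
      word_eval (mix_group n P Q) (mix_gen P Q) w" if w: "w \<in> words {1..<n}" for w
  proof (rule group.gen_hom_class[OF grp W_relators_in_words gen' _ w])
    fix r assume r: "r \<in> W_relators n"
    then have "r \<in> words {1..<n}" using W_relators_in_words by blast
    then show "word_eval (mix_group n P Q) (mix_gen P Q) r = \<one>\<^bsub>mix_group n P Q\<^esub>"
      using P.mon_relator[OF r P.base_flag] Q.mon_relator[OF r Q.base_flag] by (simp add: triv)
  qed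
  have carrier: "carrier (W n) = {W_class n w | w. w \<in> words {1..<n}}"
    by (auto simp: W_def presented_group_carrier quotient_def)
  show ?thesis
    unfolding mix_def kernel_def carrier using hom triv by auto
qed

section \<open>Duals and mirror images\<close>

lemma dual_simps [simp]:
  "face_le (dual n P) = (face_le P)\<inverse>" "rk (dual n P) F = int n - 1 - rk P F"
  "base (dual n P) = base P"
  by (simp_all add: dual_def)

lemma mirror_simps [simp]:
  "face_le (mirror P) = face_le P" "rk (mirror P) = rk P"
  "base (mirror P) = flag_adj P 0 (base P)"
  by (simp_all add: mirror_def)

lemma faces_dual [simp]: "faces (dual n P) = faces P"
  and faces_mirror [simp]: "faces (mirror P) = faces P"
  by (simp_all add: faces_def)

lemma flags_dual [simp]: "flags (dual n P) = flags P"
  and flags_mirror [simp]: "flags (mirror P) = flags P"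
proof -
  have "Chains ((face_le P)\<inverse>) = Chains (face_le P)" by (auto simp: Chains_def)
  then show "flags (dual n P) = flags P" by (simp add: flags_def)
qed (simp add: flags_def)

lemma aut_group_dual [simp]: "aut_group (dual n P) = aut_group P"
  and aut_group_mirror [simp]: "aut_group (mirror P) = aut_group P"
  by (auto simp: aut_group_def)

lemma flag_adj_mirror [simp]: "flag_adj (mirror P) = flag_adj P"
  by (simp add: flag_adj_def fun_eq_iff)

lemma flag_adj_dual:
  assumes "j < n"
  shows "flag_adj (dual n P) j = flag_adj P (n - 1 - j)"
proof -
  have "rk (dual n P) F \<noteq> int j \<longleftrightarrow> rk P F \<noteq> int (n - 1 - j)" for F
    using assms by auto
  then show ?thesis by (simp add: flag_adj_def fun_eq_iff)
qed

lemma face_less_dual [simp]: "face_less (dual n P) F G \<longleftrightarrow> face_less P G F"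
  and face_less_mirror [simp]: "face_less (mirror P) = face_less P"
  by (auto simp: face_less_def fun_eq_iff)

lemma strongly_flag_connected_dual: "strongly_flag_connected (dual n P) = strongly_flag_connected P"
  and strongly_flag_connected_mirror: "strongly_flag_connected (mirror P) = strongly_flag_connected P"
  by (simp_all add: strongly_flag_connected_def)

lemma polytope_dual:
  assumes "polytope n P"
  shows "polytope n (dual n P)"
proof -
  interpret is_polytope n P by unfold_locales fact
  have "card {H. rk (dual n P) H = rk (dual n P) F + 1 \<and> face_less (dual n P) F H \<and> face_less (dual n P) H G} = 2"
    if "face_less (dual n P) F G" "rk (dual n P) G = rk (dual n P) F + 2" for F G
  proof -
    have "{H. rk (dual n P) H = rk (dual n P) F + 1 \<and> face_less (dual n P) F H \<and> face_less (dual n P) H G}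
        = {H. rk P H = rk P G + 1 \<and> face_less P G H \<and> face_less P H F}"
      using that by auto
    then show ?thesis using diamond[of G F] that by simp
  qed
  moreover have "- 1 \<le> rk (dual n P) F \<and> rk (dual n P) F \<le> int n" if "F \<in> faces P" for F
    using rk_bounds[OF that] by auto
  moreover have "rk (dual n P) F < rk (dual n P) G" if "face_less (dual n P) F G" for F G
    using rk_strict_mono[of G F] that by simp
  \<comment> \<open>The rank n - 1 - r exchanges -1 and n, so the least and the greatest face swap
    roles.\<close>
  moreover have "(rk (dual n P) F = - 1) = (rk P F = int n)" "(rk (dual n P) F = int n) = (rk P F = - 1)" for F
    by auto
  ultimately show ?thesis
    using assms unfolding polytope_def
    by (simp add: strongly_flag_connected_dual del: dual_simps(2))
qed

lemma polytope_mirror: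
  assumes "polytope n P" and "0 < n"
  shows "polytope n (mirror P)"
proof -
  interpret is_polytope n P by unfold_locales fact
  show ?thesis
    using assms flag_adj_flag[OF base_flag, of 0]
    by (simp add: polytope_def strongly_flag_connected_mirror)
qed

lemma regular_dual: "regular (dual n P) = regular P"
  by (simp add: regular_def)

lemma chiral_polytope_dual: "chiral_polytope n P \<Longrightarrow> chiral_polytope n (dual n P)"
  by (simp add: chiral_polytope_def polytope_dual)

lemma chiral_polytope_mirror: "chiral_polytope n P \<Longrightarrow> 0 < n \<Longrightarrow> chiral_polytope n (mirror P)"
  by (simp add: chiral_polytope_def polytope_mirror)

section \<open>Regular and chiral polytopes have all basic rotations\<close>

lemma regular_rotary:
  assumes "polytope n P" and "regular P"
  shows "rotary_polytope n P"
proof -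
  interpret is_polytope n P by unfold_locales fact
  show ?thesis
  proof
    fix i assume "i \<in> {1..<n}"
    then have "flag_adj P (i - 1) (flag_adj P i (base P)) \<in> flags P"
      using base_flag by (intro flag_adj_flag) auto
    then show "\<exists>f \<in> carrier (aut_group P). f ` base P = flag_adj P (i - 1) (flag_adj P i (base P))"
      using assms(2) base_flag unfolding regular_def by blast
  qed
qed

text \<open>Adjacent flags lie in different orbits, and there are only two orbits.\<close>

lemma chiral_ex_aut:
  assumes P: "chiral_polytope n P" and \<Psi>: "\<Psi> \<in> flags P" and i: "i < n" and j: "j < n"
  shows "\<exists>f \<in> carrier (aut_group P). f ` \<Psi> = flag_adj P j (flag_adj P i \<Psi>)"
proof -
  interpret is_polytope n P using P by unfold_locales (simp add: chiral_polytope_def)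
  interpret A: group "aut_group P" by (rule group_aut_group)
  let ?o = "orbit (aut_group P) (`)"
  let ?A = "flag_adj P i \<Psi>" and ?B = "flag_adj P j (flag_adj P i \<Psi>)"
  have A: "?A \<in> flags P" and B: "?B \<in> flags P" using \<Psi> i j by (auto intro!: flag_adj_flag)
  have ne: "?o \<Psi> \<noteq> ?o ?A" "?o ?A \<noteq> ?o ?B"
    using P \<Psi> A B adjacent_flag_adjI[OF \<Psi> i] adjacent_flag_adjI[OF A j]
    unfolding chiral_polytope_def by blast+
  obtain X Y where XY: "orbits (aut_group P) (flags P) (`) = {X, Y}"
    using P by (auto simp: chiral_polytope_def card_2_iff)
  have "?o \<Psi> \<in> {X, Y}" "?o ?A \<in> {X, Y}" "?o ?B \<in> {X, Y}"
    using \<Psi> A B unfolding XY[symmetric] orbits_def by blast+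
  then have eq: "?o \<Psi> = ?o ?B" using ne by auto
  have "\<one>\<^bsub>aut_group P\<^esub> ` ?B = ?B" by (rule aut_one_image[OF flag_faces[OF B]])
  then have "?B \<in> ?o ?B" unfolding orbit_def using A.one_closed by force
  then have "?B \<in> ?o \<Psi>" using eq by simp
  then show ?thesis unfolding orbit_def by force
qed

lemma chiral_rotary:
  assumes "chiral_polytope n P"
  shows "rotary_polytope n P"
proof -
  interpret is_polytope n P using assms by unfold_locales (simp add: chiral_polytope_def)
  show ?thesis
    by unfold_locales (auto intro!: chiral_ex_aut[OF assms] base_flag)
qed

text \<open>In rank 0 there are no adjacency moves, so there is just one flag and two orbits are
  impossible. Positivity makes the 0-adjacent flag available.\<close>

lemma chiral_rank_pos:
  assumes "chiral_polytope n P"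
  shows "0 < n"
proof (rule ccontr)
  assume "\<not> 0 < n"
  interpret is_polytope n P using assms by unfold_locales (simp add: chiral_polytope_def)
  have "B = base P" if "B \<in> flags P" for B
    by (rule flag_induct[OF base_flag that]) (use \<open>\<not> 0 < n\<close> in auto)
  then have "orbits (aut_group P) (flags P) (`) \<subseteq> {orbit (aut_group P) (`) (base P)}"
    by (auto simp: orbits_def)
  then have "card (orbits (aut_group P) (flags P) (`)) \<le> 1"
    by (auto dest: card_mono[rotated])
  then show False using assms by (simp add: chiral_polytope_def)
qed

section \<open>The mixes with the dual and with its mirror image\<close>

lemma mon_dual:
  assumes "w \<in> words {1..<n}"
  shows "mon (flag_adj (dual n P)) w x = mon (flag_adj P) (delta_word n w) x"
  using mon_delta_word[OF assms, of "flag_adj (dual n P)" "flag_adj P"] flag_adj_dual by metis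

lemma W_delta_delta:
  "w \<in> words {1..<n} \<Longrightarrow> W_delta n (W_delta n (W_class n w)) = W_class n w"
  by (simp add: W_delta_class delta_word_in_words delta_word_delta_word)

text \<open>Membership asks that both \<open>w\<close> and \<open>delta_word n w\<close> fix the
  base flag; delta exchanges the two conditions. Being an involution, it maps the mix onto
  itself.\<close>

lemma mix_dual_self_dual:
  assumes "rotary_polytope n P" and "rotary_polytope n (dual n P)"
  shows "properly_self_dual n (mix n P (dual n P))"
proof -
  let ?M = "mix n P (dual n P)"
  have M: "?M = {W_class n w | w. w \<in> words {1..<n} \<and> mon (flag_adj P) w (base P) = base P \<and>
      mon (flag_adj P) (delta_word n w) (base P) = base P}"
    unfolding mix_eq[OF assms] by (auto simp: mon_dual)
  have into: "W_delta n c \<in> ?M" if "c \<in> ?M" for c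
    using that delta_word_in_words delta_word_delta_word
    unfolding M by (fastforce simp: W_delta_class)
  have "c \<in> W_delta n ` ?M" if "c \<in> ?M" for c
  proof -
    have "W_delta n (W_delta n c) = c" using that unfolding M by (auto simp: W_delta_delta)
    then show ?thesis using into[OF that] by (metis imageI)
  qed
  then show ?thesis using into by (auto simp: properly_self_dual_def struct_dual_def)
qed

lemma W_cases:
  assumes "c \<in> carrier (W n)"
  obtains w where "w \<in> words {1..<n}" and "c = W_class n w"
  using assms unfolding W_def by (rule class_cases)

lemma struct_mirror_struct_mirror:
  assumes "N \<subseteq> carrier (W n)"
  shows "struct_mirror n (struct_mirror n N) = N"
proof -
  have "W_bar n (W_bar n c) = c" if "c \<in> N" for c
  proof -
    from that assms have "c \<in> carrier (W n)" by blast
    then show ?thesis by (rule W_cases) (simp add: W_bar_class W_class_bar_bar bar_word_in_words)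
  qed
  then show ?thesis by (simp add: struct_mirror_def image_image)
qed

lemma struct_dual_carrier:
  assumes "N \<subseteq> carrier (W n)"
  shows "struct_dual n N \<subseteq> carrier (W n)"
proof -
  have "W_delta n c \<in> carrier (W n)" if "c \<in> N" for c
  proof -
    from that assms have "c \<in> carrier (W n)" by blast
    then show ?thesis
      by (rule W_cases) (simp add: W_delta_class delta_word_in_words W_class_in_carrier)
  qed
  then show ?thesis by (auto simp: struct_dual_def)
qed

text \<open>Membership of \<open>w\<close> asks that \<open>w\<close> and delta(bar(w)) fix the base
  flag. Once delta and bar may be interchanged in such conditions, both composites of the two maps
  preserve the mix.\<close>

lemma struct_mirror_dual_mix:
  assumes P: "chiral_polytope n P"
  shows "struct_mirror n (struct_dual n (mix n P (mirror (dual n P)))) = mix n P (mirror (dual n P))"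
proof -
  let ?M = "mix n P (mirror (dual n P))"
  interpret P: rotary_polytope n P by (rule chiral_rotary[OF P])
  interpret D: rotary_polytope n "dual n P" by (rule chiral_rotary[OF chiral_polytope_dual[OF P]])
  have n: "0 < n" by (rule chiral_rank_pos[OF P])
  let ?b = "base P" and ?a = "flag_adj P" and ?m = "mon (flag_adj P)"
  define stab where "stab w \<longleftrightarrow> ?m w ?b = ?b" for w
  have bar: "stab (bar_word w) \<longleftrightarrow> ?m w (?a 0 ?b) = ?a 0 ?b" if w: "w \<in> words {1..<n}" for w
  proof -
    have "?m w (?a 0 ?b) \<in> flags P" using w n P.base_flag by (simp add: P.mon_closed P.flag_adj_flag)
    then show ?thesis
      unfolding stab_def P.mon_bar_word[OF w n P.base_flag]
      using n P.base_flag P.flag_adj_flag_adj by metis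
  qed
  \<comment> \<open>In the dual, the 0-adjacent flag is the (n-1)-adjacent one, so there bar is
    conjugation by a_{n-1}.\<close>
  have bar_dual: "stab (delta_word n (bar_word w)) \<longleftrightarrow>
      ?m (delta_word n w) (?a (n - 1) ?b) = ?a (n - 1) ?b" if w: "w \<in> words {1..<n}" for w
  proof -
    have fl: "?m (delta_word n w) (?a (n - 1) ?b) \<in> flags P"
      using w n P.base_flag by (simp add: P.mon_closed P.flag_adj_flag delta_word_in_words)
    have "?m (delta_word n (bar_word w)) ?b = ?a (n - 1) (?m (delta_word n w) (?a (n - 1) ?b))"
      using D.mon_bar_word[OF w n, of ?b] w n P.base_flag
      by (simp add: mon_dual bar_word_in_words flag_adj_dual)
    then show ?thesis
      unfolding stab_def using fl n P.base_flag P.flag_adj_flag_adj[of _ "n - 1"]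
      by (metis diff_less zero_less_one)
  qed
  \<comment> \<open>The two moves start from the 0-adjacent flag: the first, of rank 0, returns to
    the base flag, and the second, of rank n - 1, leaves it.\<close>
  obtain f where f: "f \<in> carrier (aut_group P)" "f ` ?a 0 ?b = ?a (n - 1) ?b"
    using chiral_ex_aut[OF P P.flag_adj_flag[OF P.base_flag n] n, of "n - 1"] n P.base_flag
    by (auto simp: P.flag_adj_flag_adj)
  \<comment> \<open>One side says that delta(w) fixes the (n-1)-adjacent flag, the other that it
    fixes the 0-adjacent one; \<open>f\<close> carries the second flag to the first and commutes
    with the action.\<close>
  have commute: "stab (delta_word n (bar_word w)) \<longleftrightarrow> stab (bar_word (delta_word n w))"
    if w: "w \<in> words {1..<n}" for w
  proof -
    let ?d = "delta_word n w" and ?c = "?a 0 ?b"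
    have d: "?d \<in> words {1..<n}" by (rule delta_word_in_words[OF w])
    have c: "?c \<in> flags P" using n P.base_flag by (simp add: P.flag_adj_flag)
    have "?m ?d (f ` ?c) = f ` ?c \<longleftrightarrow> f ` ?m ?d ?c = f ` ?c"
      by (simp add: P.aut_mon[OF f(1) d c])
    also have "\<dots> \<longleftrightarrow> ?m ?d ?c = ?c"
      using P.mon_closed[OF d c] c
      by (intro inj_on_image_eq_iff[OF P.aut_inj_on[OF f(1)]] P.flag_faces)
    finally show ?thesis by (simp add: bar_dual[OF w] bar[OF d] f(2))
  qed
  have bar_bar: "stab (bar_word (bar_word w)) \<longleftrightarrow> stab w"
    and delta_bar_bar: "stab (delta_word n (bar_word (bar_word w))) \<longleftrightarrow> stab (delta_word n w)"
    if w: "w \<in> words {1..<n}" for w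
    using P.mon_bar_bar_word[OF w n P.base_flag] D.mon_bar_bar_word[OF w n D.base_flag] w
    by (simp_all add: stab_def mon_dual bar_word_in_words)
  have "rotary_polytope n (mirror (dual n P))"
    by (intro chiral_rotary chiral_polytope_mirror chiral_polytope_dual P n)
  note mix = mix_eq[OF chiral_rotary[OF P] this]
  have "mon (flag_adj (mirror (dual n P))) w (base (mirror (dual n P))) = base (mirror (dual n P)) \<longleftrightarrow>
      stab (delta_word n (bar_word w))" if w: "w \<in> words {1..<n}" for w
    using n by (simp add: bar_dual[OF w] mon_dual[OF w] flag_adj_dual)
  then have M: "?M = {W_class n w | w. w \<in> words {1..<n} \<and> stab w \<and> stab (delta_word n (bar_word w))}"
    unfolding mix by (metis (no_types, lifting) stab_def)
  \<comment> \<open>Delta after bar is included because it supplies the preimages needed for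
    surjectivity.\<close>
  have into: "W_bar n (W_delta n c) \<in> ?M \<and> W_delta n (W_bar n c) \<in> ?M \<and>
      W_bar n (W_delta n (W_delta n (W_bar n c))) = c" if "c \<in> ?M" for c
  proof -
    from that obtain w where w: "w \<in> words {1..<n}" and c: "c = W_class n w"
      and st: "stab w" "stab (delta_word n (bar_word w))" unfolding M by blast
    note cl = w bar_word_in_words delta_word_in_words
    \<comment> \<open>Interchanging the outer delta and bar brings the two deltas together; they
      cancel, and then the two bars do.\<close>
    have "stab (delta_word n (bar_word (delta_word n (bar_word w))))"
      using st(1) cl by (simp add: commute delta_word_delta_word bar_bar)
    then have "W_delta n (W_bar n c) \<in> ?M"
      using st(2) cl unfolding M c by (auto simp: W_bar_class W_delta_class)
    moreover have "stab (delta_word n (bar_word (bar_word (delta_word n w))))"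
      using st(1) cl by (simp add: delta_bar_bar delta_word_delta_word)
    then have "W_bar n (W_delta n c) \<in> ?M"
      using st(2) commute[OF w] cl unfolding M c by (auto simp: W_bar_class W_delta_class)
    moreover have "W_bar n (W_delta n (W_delta n (W_bar n c))) = c"
      using cl by (simp add: c W_bar_class W_delta_delta W_class_bar_bar)
    ultimately show ?thesis by blast
  qed
  show ?thesis
  proof
    show "struct_mirror n (struct_dual n ?M) \<subseteq> ?M"
      using into by (auto simp: struct_mirror_def struct_dual_def)
    show "?M \<subseteq> struct_mirror n (struct_dual n ?M)"
    proof
      fix c assume "c \<in> ?M"
      from into[OF this] show "c \<in> struct_mirror n (struct_dual n ?M)"
        unfolding struct_mirror_def struct_dual_def by (metis imageI)
    qed
  qed
qed

theorem mainTheorem6: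
  fixes n :: nat and P :: "'a based_poset"
  shows "(chiral_polytope n P \<or> directly_regular_polytope n P \<longrightarrow>
            properly_self_dual n (mix n P (dual n P))) \<and>
         (chiral_polytope n P \<longrightarrow>
            (let Q = mix n P (mirror (dual n P)) in
               Q = struct_mirror n (struct_dual n Q) \<and>
               (struct_directly_regular n Q \<longrightarrow> properly_self_dual n Q) \<and>
               (struct_chiral n Q \<longrightarrow> improperly_self_dual n Q)))"
proof (intro conjI impI)
  assume "chiral_polytope n P \<or> directly_regular_polytope n P"
  then show "properly_self_dual n (mix n P (dual n P))"
  proof
    assume "chiral_polytope n P"
    then show ?thesis by (intro mix_dual_self_dual chiral_rotary chiral_polytope_dual)
  next
    assume "directly_regular_polytope n P"
    then show ?thesis
      by (intro mix_dual_self_dual regular_rotary polytope_dual)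
        (auto simp: directly_regular_polytope_def regular_dual)
  qed
next
  assume P: "chiral_polytope n P"
  define Q where "Q = mix n P (mirror (dual n P))"
  have Q: "struct_mirror n (struct_dual n Q) = Q"
    unfolding Q_def by (rule struct_mirror_dual_mix[OF P])
  have "Q \<subseteq> carrier (W n)" by (auto simp: Q_def mix_def kernel_def)
  \<comment> \<open>Applying the mirror to both sides of Q = mirror(dual(Q)) gives this equality,
    from which both remaining claims follow.\<close>
  then have "struct_dual n Q = struct_mirror n Q"
    using Q struct_mirror_struct_mirror[OF struct_dual_carrier] by metis
  then show "let Q = mix n P (mirror (dual n P)) in
       Q = struct_mirror n (struct_dual n Q) \<and>
       (struct_directly_regular n Q \<longrightarrow> properly_self_dual n Q) \<and>
       (struct_chiral n Q \<longrightarrow> improperly_self_dual n Q)"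
    using Q by (auto simp: Q_def Let_def struct_directly_regular_def properly_self_dual_def
        improperly_self_dual_def)
qed

end
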